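(* Let $\varphi=\frac{\sqrt5-1}{2}=[0;\overline{1}]$, let $\mathscr{L}(\varphi)=\{\operatorname{rep}(\mathbf{x}):\mathbf{x}\text{ is a Sturmian word of slope }\varphi\}$, and let $$\mu_{\max}=1+\varphi,\qquad \mu_2=1+2\varphi^3,\qquad \mu_3=1+\frac{\varphi^2(\varphi^4+\varphi^2+1)}{\varphi^5+\varphi^3+1}.$$ Then the intervals $(\mu_2,\mu_{\max})$ and $(\mu_3,\mu_2)$ are maximal gaps in $\mathscr{L}(\varphi)$. Moreover, for a Sturmian word $\mathbf{x}$ of slope $\varphi$: - $\operatorname{rep}(\mathbf{x})=\mu_2$ if and only if the locating chain of $\mathbf{x}$ is $u\overline{ab}$ for some finite word $u$; - $\operatorname{rep}(\mathbf{x})=\mu_3$ if and only if the locating chain of $\mathbf{x}$ is $v\overline{b^2a^2}$ for some finite word $v$.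
   Context: Sturmian words: for an irrational $\theta\in(0,1)$, a Sturmian word of slope $\theta$ is an infinite word $\mathbf{x}=x_1x_2\dots$ over $\{0,1\}$ for which there is a real $\rho$ such that either $x_n=\lfloor (n+1)\theta+\rho\rfloor-\lfloor n\theta+\rho\rfloor$ for all $n\ge1$, or $x_n=\lceil (n+1)\theta+\rho\rceil-\lceil n\theta+\rho\rceil$ for all $n\ge1$. Exponent of repetition: $r(n,\mathbf{x})=\min\{m : x_j\dots x_{j+n-1}=x_{m-n+1}\dots x_m\text{ for some }1\le j\le m-n\}$ and $\operatorname{rep}(\mathbf{x})=\liminf_{n\to\infty} r(n,\mathbf{x})/n$. Maximal gap: an interval $(c,d)$ is a maximal gap in $\mathscr{L}(\varphi)$ if $(c,d)\cap\mathscr{L}(\varphi)=\emptyset$ and there exist Sturmian words $\mathbf{x},\mathbf{y}$ of slope $\varphi$ with $\operatorname{rep}(\mathbf{x})=c$ and $\operatorname{rep}(\mathbf{y})=d$. Locating chain (slope $\varphi$): let $M_0=0$, $M_1=1$ and $M_{k+1}=M_kM_{k-1}$ for $k\ge1$ (concatenation of words). For $k\ge1$, let $\widetilde{M}_k$ be the word $M_kM_{k-1}$ with its last two letters deleted. It is known that for a Sturmian word $\mathbf{x}$ of slope $\varphi$ and each $k\ge1$ there is a unique finite word $W_k$ satisfying one of the following, and exactly one of the three cases holds: (i) $\mathbf{x}=W_kM_k\widetilde{M}_k\dots$ with $W_k$ a non-empty suffix of $M_k$; (ii) $\mathbf{x}=W_kM_{k-1}M_k\widetilde{M}_k\dots$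 with $W_k$ a non-empty suffix of $M_k$; (iii) $\mathbf{x}=W_kM_k\widetilde{M}_k\dots$ with $W_k$ a non-empty suffix of $M_{k-1}$. The locating chain of $\mathbf{x}$ is the infinite sequence over the symbols (i), (ii), (iii) whose $k$-th term ($k\ge1$) is the case to which $\mathbf{x}$ belongs at level $k$. For slope $\varphi$ each (i) is immediately followed by (iii), and (apart from a possible first symbol (iii)) each (iii) is immediately preceded by (i). Write $a$ for the block (i)(iii) and $b$ for the symbol (ii); thus the locating chain is an infinite word in $a,b$, possibly preceded by one symbol (iii). Finite words $u,v$ are words in the symbols (i), (ii), (iii), and $\overline{w}$ denotes $www\cdots$. *)

theory Defs
  imports Complex_Main "HOL-Library.Extended_Real" "HOL-Library.Liminf_Limsup"
    "HOL-Library.Stream" "HOL-Library.Sublist"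
begin

text \<open>
  Infinite words \<open>x\<^sub>1 x\<^sub>2 \<dots>\<close> over \<open>{0,1}\<close> are streams of natural numbers. Streams are
  indexed from 0, so the letter \<open>x\<^sub>n\<close> is \<open>x !! (n - 1)\<close>.
\<close>

definition sturmian_word :: "real \<Rightarrow> nat stream \<Rightarrow> bool" where
  "sturmian_word \<theta> x \<longleftrightarrow> 0 < \<theta> \<and> \<theta> < 1 \<and> \<theta> \<notin> \<rat> \<and> (\<exists>\<rho>::real.
     (\<forall>n\<ge>1. int (x !! (n - 1)) =
        \<lfloor>real (n + 1) * \<theta> + \<rho>\<rfloor> - \<lfloor>real n * \<theta> + \<rho>\<rfloor>) \<or>
     (\<forall>n\<ge>1. int (x !! (n - 1)) =
        \<lceil>real (n + 1) * \<theta> + \<rho>\<rceil> - \<lceil>real n * \<theta> + \<rho>\<rceil>))"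

text \<open>The factor \<open>x\<^sub>j \<dots> x\<^bsub>j+n-1\<^esub>\<close> of length \<open>n\<close>, for \<open>j \<ge> 1\<close>.\<close>

definition factor_at :: "'a stream \<Rightarrow> nat \<Rightarrow> nat \<Rightarrow> 'a list" where
  "factor_at x j n = stake n (sdrop (j - 1) x)"

text \<open>The condition \<open>j \<le> m - n\<close> is written \<open>j + n \<le> m\<close> because subtraction on
  \<open>nat\<close> truncates.\<close>

definition rep_fun :: "nat \<Rightarrow> 'a stream \<Rightarrow> nat" where
  "rep_fun n x = (LEAST m. \<exists>j\<ge>1. j + n \<le> m \<and> factor_at x j n = factor_at x (m - n + 1) n)"

definition rep :: "'a stream \<Rightarrow> ereal" where
  "rep x = liminf (\<lambda>n. ereal (real (rep_fun n x) / real n))"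

definition rep_spectrum :: "real \<Rightarrow> ereal set" where
  "rep_spectrum \<theta> = {rep x | x. sturmian_word \<theta> x}"

definition maximal_gap :: "real \<Rightarrow> real \<Rightarrow> real \<Rightarrow> bool" where
  "maximal_gap \<theta> c d \<longleftrightarrow> c < d \<and> {ereal c<..<ereal d} \<inter> rep_spectrum \<theta> = {} \<and>
     (\<exists>x y. sturmian_word \<theta> x \<and> sturmian_word \<theta> y \<and> rep x = ereal c \<and> rep y = ereal d)"

definition phi :: real where
  "phi = (sqrt 5 - 1) / 2"

definition mu_max :: real where
  "mu_max = 1 + phi"

definition mu2 :: real where
  "mu2 = 1 + 2 * phi ^ 3"

definition mu3 :: real where
  "mu3 = 1 + phi ^ 2 * (phi ^ 4 + phi ^ 2 + 1) / (phi ^ 5 + phi ^ 3 + 1)"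

fun std_word :: "nat \<Rightarrow> nat list" where
  "std_word 0 = [0]"
| "std_word (Suc 0) = [1]"
| "std_word (Suc (Suc k)) = std_word (Suc k) @ std_word k"

text \<open>Used only for \<open>k \<ge> 1\<close>, where \<open>std_word k @ std_word (k - 1)\<close> has at least two letters.\<close>

definition std_word_trunc :: "nat \<Rightarrow> nat list" where
  "std_word_trunc k = butlast (butlast (std_word k @ std_word (k - 1)))"

datatype loc_symbol = Loc_i | Loc_ii | Loc_iii

text \<open>\<open>located k s W x\<close>: the word \<open>x\<close> is in case \<open>s\<close> at level \<open>k \<ge> 1\<close>, with \<open>W\<^sub>k = W\<close>.\<close>

fun located :: "nat \<Rightarrow> loc_symbol \<Rightarrow> nat list \<Rightarrow> nat stream \<Rightarrow> bool" where
  "located k Loc_i W x \<longleftrightarrow> W \<noteq> [] \<and> suffix W (std_word k) \<and>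
     (\<exists>y. x = (W @ std_word k @ std_word_trunc k) @- y)"
| "located k Loc_ii W x \<longleftrightarrow> W \<noteq> [] \<and> suffix W (std_word k) \<and>
     (\<exists>y. x = (W @ std_word (k - 1) @ std_word k @ std_word_trunc k) @- y)"
| "located k Loc_iii W x \<longleftrightarrow> W \<noteq> [] \<and> suffix W (std_word (k - 1)) \<and>
     (\<exists>y. x = (W @ std_word k @ std_word_trunc k) @- y)"

text \<open>For a Sturmian word of slope \<open>phi\<close> exactly one case holds at each level \<open>k \<ge> 1\<close>, so the
  description below is proper there. The chain starts at level 1.\<close>

definition locating_chain :: "nat stream \<Rightarrow> loc_symbol stream" where
  "locating_chain x = smap (\<lambda>k. THE s. \<exists>W. located k s W x) (fromN 1)"

definition chain_a :: "loc_symbol list" where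
  "chain_a = [Loc_i, Loc_iii]"

definition chain_b :: "loc_symbol list" where
  "chain_b = [Loc_ii]"

end

theory Submission
  imports Defs
begin

text \<open>
  A Sturmian word of slope \<open>phi\<close> codes a rotation by \<open>phi\<close>. Removing one application of the
  substitution \<open>0 \<mapsto> 1, 1 \<mapsto> 10\<close> lowers the level of the locating chain by one, and acts on the
  starting point \<open>\<alpha>\<close> of the rotation by an expanding affine map. So the \<open>k\<close>-th symbol of the chain
  is read off from the first letters of the word desubstituted \<open>k - 1\<close> times, and periodic chains
  come from periodic points of the affine maps.

  Write \<open>F\<^sub>k\<close> for the length of \<open>M\<^sub>k\<close> and \<open>w\<close> for that of \<open>W\<^sub>k\<close>. A repetition of length \<open>n\<close> of period
  \<open>p\<close> starting after \<open>i\<close> letters gives the ratio \<open>(i + p) / n\<close>, and \<open>rep x - 1\<close> is the lower limit of these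
  ratios. Ratios below \<open>phi\<close> come, in the limit, only from \<open>p = F\<^sub>k\<close>: from \<open>i = 0\<close> at a symbol (i), with ratio
  \<open>F\<^sub>k / (w + F\<^bsub>k+1\<^esub>)\<close>, and from \<open>i = w\<close> at a symbol (iii) followed by (ii), with ratio \<open>(F\<^sub>k + w) / F\<^bsub>k+2\<^esub>\<close>.
  As \<open>w\<close> grows by \<open>F\<^bsub>k-1\<^esub>\<close> at each symbol (ii) and is constant otherwise, the requirement that all
  these ratios are eventually above \<open>11 / 25 < mu3 - 1\<close> is a system of linear inequalities which only
  leaves the chains ending in \<open>a\<^sup>\<infinity>\<close>, \<open>b\<^sup>\<infinity>\<close>, \<open>(ab)\<^sup>\<infinity>\<close> and \<open>(bbaa)\<^sup>\<infinity>\<close>. On these \<open>w\<close> is,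
  up to a bounded error, a fixed combination of Fibonacci numbers, which gives the value of \<open>rep x\<close>.
\<close>

section \<open>Fibonacci words\<close>

definition fib_len :: "nat \<Rightarrow> nat" where
  "fib_len k = length (std_word k)"

lemma fib_len_simps [simp]:
  "fib_len 0 = 1" "fib_len (Suc 0) = 1" "fib_len (Suc (Suc k)) = fib_len (Suc k) + fib_len k"
  by (simp_all add: fib_len_def)

lemma fib_len_pos [simp]: "0 < fib_len k"
  by (induction k rule: std_word.induct) auto

lemma fib_len_mono: "j \<le> k \<Longrightarrow> fib_len j \<le> fib_len k"
proof (rule lift_Suc_mono_le[of fib_len])
  show "fib_len n \<le> fib_len (Suc n)" for n by (cases n) auto
qed

lemma fib_len_ge: "k \<le> fib_len k"
proof (induction k rule: std_word.induct)
  case (3 k)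
  then show ?case using fib_len_pos[of k] unfolding fib_len_simps by linarith
qed auto

lemma std_word_not_Nil [simp]: "std_word k \<noteq> []"
  using fib_len_pos[of k] by (simp add: fib_len_def del: fib_len_pos)

text \<open>Near-commutation: putting \<open>std_word (Suc k)\<close> in front of both products at k
  gives the two products at k + 1 in exchanged order, so only the last two letters ever differ.
  Every mismatch below comes from this swap.\<close>

lemma std_word_swap:
  "\<exists>a b. a \<noteq> b \<and> std_word (Suc k) @ std_word k = std_word_trunc (Suc k) @ [a, b] \<and>
     std_word k @ std_word (Suc k) = std_word_trunc (Suc k) @ [b, a]"
proof -
  have "\<exists>u a b. a \<noteq> b \<and> std_word (Suc k) @ std_word k = u @ [a, b] \<and>
     std_word k @ std_word (Suc k) = u @ [b, a]"
  proof (induction k)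
    case 0
    show ?case by (intro exI[of _ "[]"] exI[of _ 1] exI[of _ 0]) simp
  next
    case (Suc k)
    then obtain u a b where "a \<noteq> b" "std_word (Suc k) @ std_word k = u @ [a, b]"
      "std_word k @ std_word (Suc k) = u @ [b, a]" by blast
    then have "b \<noteq> a \<and> std_word (Suc (Suc k)) @ std_word (Suc k) = (std_word (Suc k) @ u) @ [b, a] \<and>
        std_word (Suc k) @ std_word (Suc (Suc k)) = (std_word (Suc k) @ u) @ [a, b]"
      unfolding std_word.simps(3) append.assoc same_append_eq by blast
    then show ?case by blast
  qed
  then obtain u a b where u: "a \<noteq> b" "std_word (Suc k) @ std_word k = u @ [a, b]"
     "std_word k @ std_word (Suc k) = u @ [b, a]" by blast
  have "std_word_trunc (Suc k) = u"
    unfolding std_word_trunc_def using u(2) by (simp add: butlast_append)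
  with u show ?thesis by blast
qed

lemma length_std_word_trunc:
  "length (std_word_trunc (Suc k)) + 2 = fib_len (Suc (Suc k))"
  using std_word_swap[of k] unfolding fib_len_def
  by (metis length_append length_Cons list.size(3) std_word.simps(3) numeral_2_eq_2)

section \<open>The Fibonacci substitution\<close>

definition sub_letter :: "nat \<Rightarrow> nat list" where
  "sub_letter a = (if a = 0 then [1] else [1, 0])"

definition sub :: "nat list \<Rightarrow> nat list" where
  "sub u = concat (map sub_letter u)"

definition ssub :: "nat stream \<Rightarrow> nat stream" where
  "ssub y = flat (smap sub_letter y)"

lemma sub_letter_not_Nil [simp]: "sub_letter a \<noteq> []"
  by (simp add: sub_letter_def)

lemma sub_simps [simp]:
  "sub [] = []" "sub (a # u) = sub_letter a @ sub u" "sub (u @ v) = sub u @ sub v"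
  by (simp_all add: sub_def)

lemma sub_eq_Nil [simp]: "sub u = [] \<longleftrightarrow> u = []"
  by (cases u) auto

lemma ssub_Stream [simp]: "ssub (a ## y) = sub_letter a @- ssub y"
  by (simp add: ssub_def)

lemma ssub_shift [simp]: "ssub (u @- y) = sub u @- ssub y"
  by (induction u) auto

lemma ssub_starts: "\<exists>y'. ssub y = 1 ## y'"
  by (cases y) (auto simp: sub_letter_def)

lemma sub_std_word: "sub (std_word k) = std_word (Suc k)"
  by (induction k rule: std_word.induct) (auto simp: sub_letter_def)

text \<open>The images of the two swapped letters are 110 and 101. Their common first letter 1
  extends the common prefix, and what remains is again a swapped pair.\<close>

lemma sub_std_word_trunc: "sub (std_word_trunc (Suc k)) @ [1] = std_word_trunc (Suc (Suc k))"
proof -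
  obtain a b where ab: "std_word (Suc k) @ std_word k = std_word_trunc (Suc k) @ [a, b]"
     "std_word k @ std_word (Suc k) = std_word_trunc (Suc k) @ [b, a]"
     using std_word_swap[of k] by blast
  obtain c d where cd: "c \<noteq> d" "std_word (Suc (Suc k)) @ std_word (Suc k) = std_word_trunc (Suc (Suc k)) @ [c, d]"
     "std_word (Suc k) @ std_word (Suc (Suc k)) = std_word_trunc (Suc (Suc k)) @ [d, c]"
     using std_word_swap[of "Suc k"] by blast
  have "std_word_trunc (Suc (Suc k)) @ [c, d] = sub (std_word_trunc (Suc k)) @ sub [a, b]"
    using arg_cong[OF ab(1), of sub] cd(2) by (simp add: sub_std_word del: std_word.simps)
  moreover have "std_word_trunc (Suc (Suc k)) @ [d, c] = sub (std_word_trunc (Suc k)) @ sub [b, a]"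
    using arg_cong[OF ab(2), of sub] cd(3) by (simp add: sub_std_word del: std_word.simps)
  ultimately show ?thesis using cd(1)
    by (auto simp: sub_letter_def split: if_splits)
qed

lemma set_std_word: "set (std_word k) \<subseteq> {0, 1}"
  by (induction k rule: std_word.induct) auto

lemma set_std_word_trunc: "set (std_word_trunc k) \<subseteq> {0, 1}"
  unfolding std_word_trunc_def using set_std_word[of k] set_std_word[of "k - 1"]
  by (auto dest!: in_set_butlastD)

text \<open>Each block of the image starts with its only 1, so the block boundaries can be read off.
  The extra 1 after \<open>sub u\<close> certifies that the last block is complete.\<close>

lemma ssub_decode:
  assumes "ssub y = sub u @- 1 ## t" "sset y \<subseteq> {0, 1}" "set u \<subseteq> {0, 1}"
  shows "\<exists>y'. y = u @- y'"
  using assms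
proof (induction u arbitrary: y)
  case (Cons a u)
  obtain b y1 where y: "y = b ## y1" by (cases y)
  have 1: "\<exists>r. sub u @- 1 ## t = 1 ## r"
    by (cases u) (auto simp: sub_letter_def)
  obtain r1 where r1: "ssub y1 = 1 ## r1" using ssub_starts by blast
  have ba: "b = a" and "ssub y1 = sub u @- 1 ## t"
    using Cons.prems 1 r1 unfolding y by (auto simp: sub_letter_def split: if_splits)
  then obtain y' where "y1 = u @- y'"
    using Cons.IH[of y1] Cons.prems unfolding y by auto
  then show ?case using y ba by auto
qed auto

lemma suffix_subD:
  assumes "suffix w (sub u)" "set u \<subseteq> {0, 1}"
  shows "(\<exists>v. suffix v u \<and> w = sub v) \<or> (\<exists>v. suffix (1 # v) u \<and> w = 0 # sub v)"
  using assms
proof (induction u)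
  case Nil
  then show ?case by auto
next
  case (Cons a u)
  consider "suffix w (sub u)" | l where "suffix l (sub_letter a)" "l \<noteq> []" "w = l @ sub u"
    using Cons.prems(1) suffix_bot.extremum suffix_append[of w "sub_letter a" "sub u"]
    by (metis append_Nil sub_simps(2) suffix_order.refl)
  then show ?case
  proof cases
    case 1
    then show ?thesis using Cons by (auto simp: suffix_Cons)
  next
    case 2
    then have "(l = sub_letter a) \<or> (a = 1 \<and> l = [0])"
      using Cons.prems(2) by (auto simp: sub_letter_def suffix_Cons split: if_splits)
    then show ?thesis
    proof
      assume "l = sub_letter a"
      then show ?thesis using 2 by (intro disjI1 exI[of _ "a # u"]) auto
    next
      assume "a = 1 \<and> l = [0]"
      then show ?thesis using 2 by (intro disjI2 exI[of _ "u"]) auto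
    qed
  qed
qed

section \<open>Codings of the rotation by the golden mean\<close>

lemma phi_sq: "phi * phi = 1 - phi"
proof -
  have "sqrt 5 * sqrt 5 = 5" by simp
  then show ?thesis unfolding phi_def by (simp add: field_simps)
qed

lemma phi_bounds: "618033 / 1000000 < phi" "phi < 618034 / 1000000"
proof -
  have "2236066 / 1000000 < sqrt (5::real)" "sqrt (5::real) < 2236068 / 1000000"
    by (rule real_less_rsqrt, simp add: power2_eq_square)
       (rule real_less_lsqrt, simp_all add: power2_eq_square)
  then show "618033 / 1000000 < phi" "phi < 618034 / 1000000" unfolding phi_def by simp_all
qed

lemma phi_pos [simp]: "0 < phi" and phi_less_1 [simp]: "phi < 1"
  using phi_bounds by simp_all

lemma phi_nonneg [simp]: "0 \<le> phi" and phi_neq_0 [simp]: "phi \<noteq> 0" and phi_le_1 [simp]: "phi \<le> 1"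
  using phi_pos phi_less_1 by linarith+

lemma phi_cube: "phi ^ 3 = 2 * phi - 1"
proof -
  have "phi ^ 3 = phi * (phi * phi)" by (simp add: power3_eq_cube)
  also have "\<dots> = phi * (1 - phi)" by (simp add: phi_sq)
  also have "\<dots> = phi - phi * phi" by (simp add: algebra_simps)
  finally show ?thesis unfolding phi_sq by simp
qed

lemma one_plus_phi_pos [simp]: "0 < 1 + phi"
  using phi_pos by linarith

text \<open>\<open>\<alpha>\<close> is a position on the circle. Both ends of the interval are
  allowed, and at \<open>1 - phi\<close> either letter is, so codings by floors (points in
  [0, 1)) and by ceilings (points in (0, 1]) are treated at once.\<close>

coinductive codes :: "real \<Rightarrow> nat stream \<Rightarrow> bool" where
  "0 \<le> \<alpha> \<Longrightarrow> \<alpha> \<le> 1 \<Longrightarrow> a = 0 \<or> a = 1 \<Longrightarrow> codes (\<alpha> + phi - real a) y \<Longrightarrow> codes \<alpha> (a ## y)"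

lemma codes_bounds: "codes \<alpha> x \<Longrightarrow> 0 \<le> \<alpha> \<and> \<alpha> \<le> 1"
  by (auto elim: codes.cases)

lemma codes_hd: "codes \<alpha> x \<Longrightarrow> shd x = 0 \<or> shd x = 1"
  by (auto elim: codes.cases)

lemma codes_stl: "codes \<alpha> x \<Longrightarrow> codes (\<alpha> + phi - real (shd x)) (stl x)"
  by (auto elim: codes.cases)

lemma codes_sset: "codes \<alpha> x \<Longrightarrow> sset x \<subseteq> {0, 1}"
proof -
  assume "codes \<alpha> x"
  have "y \<in> {0, 1}" if "y \<in> sset x" "codes \<alpha> x" for y
    using that by (induction y x arbitrary: \<alpha> rule: sset_induct) (auto dest: codes_hd codes_stl)
  then show ?thesis using \<open>codes \<alpha> x\<close> by blast
qed

lemma codes_hd_0: "codes \<alpha> x \<Longrightarrow> shd x = 0 \<Longrightarrow> \<alpha> \<le> 1 - phi"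
  using codes_bounds[OF codes_stl[of \<alpha> x]] by auto

lemma codes_hd_1: "codes \<alpha> x \<Longrightarrow> shd x = 1 \<Longrightarrow> 1 - phi \<le> \<alpha>"
  using codes_bounds[OF codes_stl[of \<alpha> x]] by auto

lemma codes_01: "codes \<alpha> x \<Longrightarrow> shd x = 0 \<Longrightarrow> shd (stl x) = 1"
  using codes_bounds[of \<alpha> x] codes_hd[OF codes_stl[of \<alpha> x]] codes_hd_0[OF codes_stl[of \<alpha> x]] phi_bounds
  by fastforce

section \<open>Desubstitution and its effect on the coded point\<close>

primcorec desub_aux :: "nat stream \<Rightarrow> nat stream" where
  "shd (desub_aux x) = (if shd (stl x) = 0 then 1 else 0)"
| "stl (desub_aux x) = desub_aux (if shd (stl x) = 0 then stl (stl x) else stl x)"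

text \<open>A word starting with \<open>0\<close> is desubstituted as if it were preceded by the letter \<open>1\<close>.\<close>

definition desub :: "nat stream \<Rightarrow> nat stream" where
  "desub x = (if shd x = 0 then 1 ## desub_aux (stl x) else desub_aux x)"

lemma desub_aux_00: "desub_aux (a ## 0 ## x) = 1 ## desub_aux x"
  by (subst desub_aux.ctr) simp

lemma desub_aux_01: "b \<noteq> 0 \<Longrightarrow> desub_aux (a ## b ## x) = 0 ## desub_aux (b ## x)"
  by (subst desub_aux.ctr) simp

lemma codes_1_cases:
  assumes "codes \<alpha> x" "shd x = 1"
  obtains (10) y where "x = 1 ## 0 ## y" "shd y = 1" "codes (\<alpha> + 2 * phi - 1) y"
  | (11) y where "x = 1 ## 1 ## y" "codes (\<alpha> + phi - 1) (1 ## y)"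
proof -
  obtain b y where x: "x = 1 ## b ## y" using assms(2) by (metis stream.collapse)
  have 1: "codes (\<alpha> + phi - 1) (b ## y)" using codes_stl[OF assms(1)] x by simp
  have 2: "codes (\<alpha> + 2 * phi - 1 - b) y" using codes_stl[OF 1] by (simp add: algebra_simps)
  show ?thesis
    using codes_hd[OF 1] codes_01[OF 1] 1 2 x that by auto
qed

text \<open>The map sends [1 - phi, 1] onto [0, 1] and multiplies increments by -(1 + phi). A block
  10 moves the point by 2 phi - 1, which becomes phi - 1, the step of the letter 1; a block 1 moves
  it by phi - 1, which becomes phi, the step of the letter 0.\<close>

lemma codes_desub_aux:
  assumes "codes \<alpha> x" "shd x = 1"
  shows "codes ((1 + phi) * (1 - \<alpha>)) (desub_aux x)"
proof -
  have "codes \<beta> y" if "\<exists>\<alpha> x. codes \<alpha> x \<and> shd x = 1 \<and> \<beta> = (1 + phi) * (1 - \<alpha>) \<and> y = desub_aux x" for \<beta> y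
    using that
  proof (coinduction arbitrary: \<beta> y rule: codes.coinduct)
    case codes
    then obtain \<alpha> x where x: "codes \<alpha> x" "shd x = 1" "\<beta> = (1 + phi) * (1 - \<alpha>)" "y = desub_aux x" by blast
    have b0: "0 \<le> \<beta>" using codes_bounds[OF x(1)] one_plus_phi_pos unfolding x(3)
      by (intro mult_nonneg_nonneg) linarith+
    have "\<beta> \<le> (1 + phi) * phi" unfolding x(3) 
      using codes_hd_1[OF x(1,2)] one_plus_phi_pos by (intro mult_left_mono) linarith+
    then have b1: "\<beta> \<le> 1" using phi_sq by (simp add: algebra_simps)
    from x(1,2) show ?case
    proof (cases rule: codes_1_cases)
      case (10 z)
      have "\<beta> + phi - 1 = (1 + phi) * (1 - (\<alpha> + 2 * phi - 1))"
        unfolding x(3) using phi_sq by (simp add: algebra_simps)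
      then have "codes (\<beta> + phi - real 1) (desub_aux z) \<or> (\<exists>\<alpha> x. codes \<alpha> x \<and> shd x = 1 \<and>
          \<beta> + phi - real 1 = (1 + phi) * (1 - \<alpha>) \<and> desub_aux z = desub_aux x)"
        using 10(2,3) by (intro disjI2 exI[of _ "\<alpha> + 2 * phi - 1"] exI[of _ z]) simp
      moreover have "y = 1 ## desub_aux z" unfolding x(4) 10(1) by (rule desub_aux_00)
      ultimately show ?thesis using b0 b1
        by (intro exI[of _ \<beta>] exI[of _ 1] exI[of _ "desub_aux z"]) (simp, blast)
    next
      case (11 z)
      have "\<beta> + phi = (1 + phi) * (1 - (\<alpha> + phi - 1))"
        unfolding x(3) using phi_sq by (simp add: algebra_simps)
      then have "codes (\<beta> + phi - real 0) (desub_aux (1 ## z)) \<or> (\<exists>\<alpha> x. codes \<alpha> x \<and> shd x = 1 \<and>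
          \<beta> + phi - real 0 = (1 + phi) * (1 - \<alpha>) \<and> desub_aux (1 ## z) = desub_aux x)"
        using 11(2) by (intro disjI2 exI[of _ "\<alpha> + phi - 1"] exI[of _ "1 ## z"]) simp
      moreover have "y = 0 ## desub_aux (1 ## z)" unfolding x(4) 11(1) by (rule desub_aux_01) simp
      ultimately show ?thesis using b0 b1
        by (intro exI[of _ \<beta>] exI[of _ 0] exI[of _ "desub_aux (1 ## z)"]) (simp, blast)
    qed
  qed
  then show ?thesis using assms by blast
qed

lemma ssub_desub_aux:
  assumes "codes \<alpha> x" "shd x = 1"
  shows "ssub (desub_aux x) = x"
proof -
  have "ssub (desub_aux x) !! n = x !! n" for n
    using assms
  proof (induction n arbitrary: \<alpha> x rule: less_induct)
    case (less n)
    from less.prems show ?case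
    proof (cases rule: codes_1_cases)
      case (10 y)
      have "ssub (desub_aux x) = 1 ## 0 ## ssub (desub_aux y)"
        unfolding 10 desub_aux_00 by (simp add: sub_letter_def)
      consider "n = 0" | "n = 1" | m where "n = Suc (Suc m)" by (metis One_nat_def not0_implies_Suc)
      then show ?thesis
        using less.IH[OF _ 10(3,2)] \<open>ssub (desub_aux x) = _\<close> 10(1)
        by cases (simp_all del: One_nat_def, simp)
    next
      case (11 y)
      have "ssub (desub_aux x) = 1 ## ssub (desub_aux (1 ## y))"
        unfolding 11 by (subst desub_aux_01) (simp_all add: sub_letter_def)
      then show ?thesis using less.IH[OF _ 11(2)] 11(1)
        by (cases n) auto
    qed
  qed
  then show ?thesis by (metis stream_smap_nats stream.map_cong)
qed

text \<open>For a first letter 0 the preceding point \<open>\<alpha> - phi + 1\<close>, with letter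
  1, is desubstituted instead; as (1 + phi) phi = 1, this gives
  \<open>1 - (1 + phi) * \<alpha>\<close>.\<close>

lemma codes_desub:
  assumes "codes \<alpha> x"
  shows "codes (if shd x = 0 then 1 - (1 + phi) * \<alpha> else (1 + phi) * (1 - \<alpha>)) (desub x)"
proof (cases "shd x = 0")
  case True
  have "codes ((1 + phi) * (1 - (\<alpha> + phi))) (desub_aux (stl x))"
    using codes_desub_aux[OF codes_stl[OF assms] codes_01[OF assms True]] True by simp
  moreover have "(1 + phi) * (1 - (\<alpha> + phi)) = (1 - (1 + phi) * \<alpha>) + phi - 1"
    using phi_sq by (simp add: algebra_simps)
  moreover have "(1 + phi) * \<alpha> \<le> (1 + phi) * (1 - phi)"
    using codes_hd_0[OF assms True] one_plus_phi_pos by (intro mult_left_mono) linarith+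
  then have "(1 + phi) * \<alpha> \<le> phi" using phi_sq by (simp add: algebra_simps)
  then have "(1 + phi) * \<alpha> \<le> 1" using phi_less_1 by linarith
  moreover have "0 \<le> (1 + phi) * \<alpha>" using codes_bounds[OF assms] one_plus_phi_pos
    by (intro mult_nonneg_nonneg) linarith+
  ultimately show ?thesis using True by (auto simp: desub_def intro: codes.intros)
qed (use assms codes_hd[OF assms] codes_desub_aux in \<open>auto simp: desub_def\<close>)

lemma ssub_desub_1: "codes \<alpha> x \<Longrightarrow> shd x = 1 \<Longrightarrow> ssub (desub x) = x"
  using ssub_desub_aux by (simp add: desub_def)

lemma ssub_desub_0: 
  assumes "codes \<alpha> x" "shd x = 0" 
  shows "desub x = 1 ## stl (desub x)" "x = 0 ## ssub (stl (desub x))"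
  using assms ssub_desub_aux[OF codes_stl[OF assms(1)] codes_01[OF assms]] stream.collapse[of x]
  by (auto simp: desub_def)

section \<open>The locating chain\<close>

text \<open>The case at level 1, where the words involved are 1, 0 and the empty word: x starts with
  11 in case (i), with 101 in case (ii), with 01 in case (iii).\<close>

definition sym_init :: "nat stream \<Rightarrow> loc_symbol" where
  "sym_init x = (if shd x = 0 then Loc_iii else if shd (stl x) = 0 then Loc_ii else Loc_i)"

text \<open>Index j belongs to level j + 1.\<close>

definition chain_sym :: "nat \<Rightarrow> nat stream \<Rightarrow> loc_symbol" where
  "chain_sym j x = sym_init ((desub ^^ j) x)"

text \<open>\<open>c\<close> is the first letter before desubstitution; if it is 0, the 1 imagined
  in front of it has to be dropped again.\<close>

definition lift_word :: "nat \<Rightarrow> nat list \<Rightarrow> nat list" where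
  "lift_word c v = (if c = 0 then tl (sub v) else sub v)"

fun loc_word :: "nat \<Rightarrow> nat stream \<Rightarrow> nat list" where
  "loc_word 0 x = [shd x]"
| "loc_word (Suc j) x = lift_word (shd x) (loc_word j (desub x))"

text \<open>Together with \<open>loc_sep\<close> this brings the three cases of
  \<open>located\<close> to one shape, so that passing between levels needs no case split on the
  symbol.\<close>

definition loc_home :: "nat \<Rightarrow> loc_symbol \<Rightarrow> nat list" where
  "loc_home j s = (if s = Loc_iii then std_word j else std_word (Suc j))"

definition loc_sep :: "nat \<Rightarrow> loc_symbol \<Rightarrow> nat list" where
  "loc_sep j s = (if s = Loc_ii then std_word j else [])"

lemma located_iff:
  "located (Suc j) s W x \<longleftrightarrow> W \<noteq> [] \<and> suffix W (loc_home j s) \<and>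
     (\<exists>y. x = (W @ loc_sep j s @ std_word (Suc j) @ std_word_trunc (Suc j)) @- y)"
  by (cases s) (auto simp: loc_home_def loc_sep_def)

lemma sub_loc_home: "sub (loc_home j s) = loc_home (Suc j) s"
  by (simp add: loc_home_def sub_std_word del: std_word.simps)

lemma sub_loc_sep: "sub (loc_sep j s) = loc_sep (Suc j) s"
  by (simp add: loc_sep_def sub_std_word del: std_word.simps)

lemma set_loc_home: "set (loc_home j s) \<subseteq> {0, 1}"
  and set_loc_sep: "set (loc_sep j s) \<subseteq> {0, 1}"
  using set_std_word[of j] set_std_word[of "Suc j"] by (auto simp: loc_home_def loc_sep_def)

lemma sub_tail:
  "sub (loc_sep j s @ std_word (Suc j) @ std_word_trunc (Suc j)) @ [1] =
     loc_sep (Suc j) s @ std_word (Suc (Suc j)) @ std_word_trunc (Suc (Suc j))"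
  by (simp add: sub_loc_sep sub_std_word sub_std_word_trunc del: std_word.simps One_nat_def)

lemma suffix_sub: "suffix u v \<Longrightarrow> suffix (sub u) (sub v)"
  by (auto simp: suffix_def)

text \<open>The substitution maps a factorisation to the one a level up; the single letter by which
  the image of the truncated word falls short is the 1 that starts the image of the rest.\<close>

lemma located_lift:
  assumes "codes \<alpha> x" "located (Suc j) s V (desub x)"
  shows "located (Suc (Suc j)) s (lift_word (shd x) V) x"
proof -
  let ?R = "loc_sep j s @ std_word (Suc j) @ std_word_trunc (Suc j)"
  obtain y where V: "V \<noteq> []" "suffix V (loc_home j s)" "desub x = (V @ ?R) @- y"
    using assms(2) unfolding located_iff by blast
  obtain y' where y': "ssub y = 1 ## y'" using ssub_starts by blast
  have R: "sub ?R @- 1 ## y' = (loc_sep (Suc j) s @ std_word (Suc (Suc j)) @ std_word_trunc (Suc (Suc j))) @- y'"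
    unfolding sub_tail[symmetric] by simp
  have suf: "suffix (sub V) (loc_home (Suc j) s)"
    using suffix_sub[OF V(2)] by (simp only: sub_loc_home)
  show ?thesis
  proof (cases "shd x = 0")
    case True
    note d = ssub_desub_0[OF assms(1) True]
    obtain V' where V': "V = 1 # V'" using d(1) V(1,3) by (cases V) (simp, metis append_Cons shift.simps(2) stream.sel(1))
    have "stl (desub x) = (V' @ ?R) @- y" using V(3) V' by simp
    then have x: "x = 0 ## sub V' @- sub ?R @- 1 ## y'" using d(2) y' by simp
    then have "x = (tl (sub V) @ loc_sep (Suc j) s @ std_word (Suc (Suc j)) @ std_word_trunc (Suc (Suc j))) @- y'"
      unfolding R V' by (simp add: sub_letter_def)
    moreover have "suffix (tl (sub V)) (loc_home (Suc j) s)"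
      using suffix_order.trans[OF suffix_tl suf] .
    ultimately show ?thesis using True V' unfolding located_iff lift_word_def
      by (auto simp: sub_letter_def)
  next
    case False
    then have "x = ssub (desub x)" using ssub_desub_1[OF assms(1)] codes_hd[OF assms(1)] by auto
    then have "x = sub V @- sub ?R @- 1 ## y'" using V(3) y' by simp
    then have "x = (sub V @ loc_sep (Suc j) s @ std_word (Suc (Suc j)) @ std_word_trunc (Suc (Suc j))) @- y'"
      unfolding R by simp
    then show ?thesis using False V(1) suf unfolding located_iff lift_word_def by auto
  qed
qed

text \<open>Decoding inverts the lift. The two alternatives of \<open>suffix_subD\<close> for W are
  the first letters 1 and 0 of x, and the final 1 of the truncated word is the lookahead required by
  \<open>ssub_decode\<close>.\<close>

lemma located_lower:
  assumes "codes \<alpha> x" "located (Suc (Suc j)) s W x"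
  shows "\<exists>V. located (Suc j) s V (desub x) \<and> W = lift_word (shd x) V"
proof -
  let ?R = "loc_sep j s @ std_word (Suc j) @ std_word_trunc (Suc j)"
  obtain y where W: "W \<noteq> []" "suffix W (sub (loc_home j s))" "x = (W @ sub ?R @ [1]) @- y"
    using assms(2) unfolding located_iff sub_tail sub_loc_home by blast
  have setR: "set ?R \<subseteq> {0, 1}"
    using set_loc_sep[of j s] set_std_word[of "Suc j"] set_std_word_trunc[of "Suc j"] by simp
  have shd: "shd x = hd W" using W by simp
  have sd: "sset (desub x) \<subseteq> {0, 1}" using codes_sset[OF codes_desub[OF assms(1)]] .
  from suffix_subD[OF W(2) set_loc_home] show ?thesis
  proof (elim disjE exE conjE)
    fix v assume v: "suffix v (loc_home j s)" "W = sub v"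
    then have "v \<noteq> []" using W(1) by auto
    then have x1: "shd x = 1" unfolding shd v(2) by (cases v) (auto simp: sub_letter_def)
    have "ssub (desub x) = sub (v @ ?R) @- 1 ## y"
      using ssub_desub_1[OF assms(1) x1] W(3) v(2) by simp
    moreover have "set (v @ ?R) \<subseteq> {0, 1}" using setR set_mono_suffix[OF v(1)] set_loc_home[of j s]
      by (auto dest: subsetD)
    ultimately obtain y' where "desub x = (v @ ?R) @- y'"
      using ssub_decode sd by blast
    then show ?thesis using x1 v \<open>v \<noteq> []\<close> unfolding located_iff
      by (intro exI[of _ v]) (auto simp: lift_word_def)
  next
    fix v assume v: "suffix (1 # v) (loc_home j s)" "W = 0 # sub v"
    then have x0: "shd x = 0" unfolding shd by simp
    note d = ssub_desub_0[OF assms(1) x0]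
    have "0 ## ssub (stl (desub x)) = 0 ## sub (v @ ?R) @- 1 ## y"
      using d(2) W(3) v(2) by simp
    then have "ssub (stl (desub x)) = sub (v @ ?R) @- 1 ## y" by simp
    moreover have "set (v @ ?R) \<subseteq> {0, 1}" using setR set_mono_suffix[OF v(1)] set_loc_home[of j s]
      by (auto dest: subsetD)
    moreover have "sset (stl (desub x)) \<subseteq> {0, 1}" using sd by (meson stl_sset subset_iff)
    ultimately obtain y' where "stl (desub x) = (v @ ?R) @- y'"
      using ssub_decode by blast
    then have "desub x = ((1 # v) @ ?R) @- y'" using d(1) by simp
    then show ?thesis using x0 v unfolding located_iff
      by (intro exI[of _ "1 # v"]) (auto simp: lift_word_def sub_letter_def)
  qed
qed

lemma located_1:
  assumes "codes \<alpha> x"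
  shows "located (Suc 0) s W x \<longleftrightarrow> s = sym_init x \<and> W = [shd x]"
proof -
  obtain a b c y where x: "x = a ## b ## c ## y" by (metis stream.exhaust)
  have 1: "codes (\<alpha> + phi - real a) (b ## c ## y)" using codes_stl[OF assms] x by simp
  have a: "a = 0 \<or> a = 1" "a = 0 \<Longrightarrow> b = 1" "b = 0 \<or> b = 1" "b = 0 \<Longrightarrow> c = 1"
    using codes_hd[OF assms] codes_01[OF assms] codes_hd[OF 1] codes_01[OF 1] x by auto
  have t: "std_word_trunc (Suc 0) = []" by (simp add: std_word_trunc_def)
  have suf: "W \<noteq> [] \<and> suffix W [q] \<longleftrightarrow> W = [q]" for q :: nat by (auto simp: suffix_Cons)
  have sh: "(\<exists>z. w @- z = a ## b ## c ## y) \<longleftrightarrow> take 3 w = take (length w) [a,b,c]" if "length w \<le> 3" for w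
    using that by (cases w; cases "tl w"; cases "tl (tl w)"; cases "tl (tl (tl w))") auto
  have "located (Suc 0) s W x \<longleftrightarrow> W = loc_home 0 s \<and> (\<exists>z. ([hd (loc_home 0 s)] @ loc_sep 0 s @ [1]) @- z = a ## b ## c ## y)"
    unfolding located_iff t x using suf by (cases s) (auto simp: loc_home_def; metis)+
  also have "\<dots> \<longleftrightarrow> s = sym_init x \<and> W = [shd x]"
    using a by (cases s) (auto simp: sh loc_home_def loc_sep_def x sym_init_def)
  finally show ?thesis .
qed

text \<open>Existence and uniqueness of the case and of W at once, which makes the description in
  \<open>locating_chain\<close> proper.\<close>

theorem located_Suc_iff:
  assumes "codes \<alpha> x"
  shows "located (Suc j) s W x \<longleftrightarrow> s = chain_sym j x \<and> W = loc_word j x"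
  using assms
proof (induction j arbitrary: \<alpha> x W)
  case 0
  then show ?case using located_1[OF 0] by (simp add: chain_sym_def)
next
  case (Suc j)
  note IH = Suc.IH[OF codes_desub[OF Suc.prems]]
  have chain_sym: "chain_sym (Suc j) x = chain_sym j (desub x)" by (simp add: chain_sym_def funpow_swap1)
  show ?case
    using located_lower[OF Suc.prems, of j s W] located_lift[OF Suc.prems, of j s] IH chain_sym by auto
qed

lemma locating_chain_snth:
  assumes "codes \<alpha> x"
  shows "locating_chain x !! n = chain_sym n x"
  unfolding locating_chain_def snth_smap
  using located_Suc_iff[OF assms] by (simp del: located.simps)

lemma codes_funpow_desub: "codes \<alpha> x \<Longrightarrow> \<exists>\<beta>. codes \<beta> ((desub ^^ j) x)"
  by (induction j) (auto dest: codes_desub)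

text \<open>A word starting with 11 has the first block 1, so its desubstitution starts with 0,
  which is case (iii). A start with 0 or 10 gives a desubstitution starting with 1, whence
  \<open>sym_not_i\<close>.\<close>

lemma sym_i_iii:
  assumes "codes \<alpha> x" "chain_sym j x = Loc_i"
  shows "chain_sym (Suc j) x = Loc_iii"
proof -
  obtain \<beta> where "codes \<beta> ((desub ^^ j) x)" using codes_funpow_desub[OF assms(1)] by blast
  then show ?thesis using assms(2) codes_hd
    by (force simp: chain_sym_def sym_init_def desub_def split: if_splits)
qed

lemma sym_not_i:
  assumes "chain_sym j x \<noteq> Loc_i"
  shows "chain_sym (Suc j) x \<noteq> Loc_iii"
  using assms by (auto simp: chain_sym_def sym_init_def desub_def split: if_splits)

lemma loc_word_not_Nil: "codes \<alpha> x \<Longrightarrow> loc_word j x \<noteq> []"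
  using located_Suc_iff[of \<alpha> x j "chain_sym j x" "loc_word j x"] unfolding located_iff by simp

lemma loc_word_Suc:
  assumes "codes \<alpha> x"
  shows "loc_word (Suc j) x = loc_word j x @ loc_sep j (chain_sym j x)"
  using assms
proof (induction j arbitrary: \<alpha> x)
  case 0
  then show ?case using codes_hd[OF 0] codes_hd[OF codes_stl[OF 0]]
    by (auto simp: desub_def lift_word_def sub_letter_def loc_sep_def chain_sym_def sym_init_def)
next
  case (Suc j)
  have chain_sym: "chain_sym (Suc j) x = chain_sym j (desub x)" by (simp add: chain_sym_def funpow_swap1)
  have "loc_word (Suc (Suc j)) x = lift_word (shd x) (loc_word j (desub x) @ loc_sep j (chain_sym j (desub x)))"
    using Suc.IH[OF codes_desub[OF Suc.prems]] by simp
  also have "\<dots> = loc_word (Suc j) x @ loc_sep (Suc j) (chain_sym (Suc j) x)"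
    using loc_word_not_Nil[OF codes_desub[OF Suc.prems], of j]
    by (simp add: lift_word_def sub_loc_sep chain_sym)
  finally show ?case .
qed

definition loc_len :: "nat \<Rightarrow> nat stream \<Rightarrow> nat" where
  "loc_len j x = length (loc_word j x)"

lemma loc_len_Suc:
  "codes \<alpha> x \<Longrightarrow> loc_len (Suc j) x = loc_len j x + (if chain_sym j x = Loc_ii then fib_len j else 0)"
  using loc_word_Suc[of \<alpha> x j] by (simp add: loc_len_def loc_sep_def fib_len_def)

lemma loc_len_le: "codes \<alpha> x \<Longrightarrow> loc_len j x \<le> fib_len (Suc j)"
  using located_Suc_iff[of \<alpha> x j "chain_sym j x" "loc_word j x"] fib_len_mono[of j "Suc j"]
  unfolding located_iff loc_len_def loc_home_def fib_len_def
  by (auto dest!: suffix_length_le split: if_splits)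

section \<open>Diophantine approximation of the golden mean\<close>

text \<open>Both sides obey the Fibonacci recurrence, because -phi is a root of t^2 = t + 1.\<close>

lemma fib_len_phi: "real (fib_len (Suc k)) * phi - real (fib_len k) = - ((- phi) ^ (k + 2))"
proof (induction k rule: std_word.induct)
  case 1
  show ?case using phi_sq by (simp add: power2_eq_square)
next
  case 2
  show ?case using phi_cube by (simp add: power3_eq_cube)
next
  case (3 k)
  have "(- phi) ^ (Suc (Suc k) + 2) = (phi * phi) * (- phi) ^ (k + 2)" by simp
  also have "\<dots> = (- phi) ^ (Suc k + 2) + (- phi) ^ (k + 2)"
    unfolding phi_sq by (simp add: algebra_simps)
  finally show ?case using 3 by (simp add: algebra_simps)
qed

lemma fib_len_phi_int: "\<exists>P::int. real (fib_len k) * phi - P = - ((- phi) ^ (k + 1))"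
proof (cases k)
  case 0
  then show ?thesis by (intro exI[of _ 0]) simp
next
  case (Suc m)
  then show ?thesis using fib_len_phi[of m] by (intro exI[of _ "int (fib_len m)"]) simp
qed

lemma phi_power_diff: "phi ^ k - phi ^ (k + 2) = phi ^ (k + 1)"
proof -
  have "phi ^ (k + 2) = phi ^ k * (phi * phi)" by (simp add: power2_eq_square)
  then show ?thesis unfolding phi_sq by (simp add: algebra_simps)
qed

lemma phi_power_antimono: "j \<le> k \<Longrightarrow> phi ^ k \<le> phi ^ j"
  by (rule power_decreasing) simp_all

text \<open>The Fibonacci lengths are the denominators of the convergents of phi. Write F(k) for
  \<open>fib_len k\<close>. For p beyond F(k), subtracting F(k) from p costs an error of phi^(k+1),
  and phi^(k-1) - phi^(k+1) = phi^k remains.\<close>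

lemma best_approx:
  assumes "0 < p" "p < fib_len (Suc k)"
  shows "phi ^ (k + 1) \<le> \<bar>real p * phi - of_int P\<bar>"
    and "fib_len k < p \<Longrightarrow> phi ^ k \<le> \<bar>real p * phi - of_int P\<bar>"
proof -
  have "0 < p \<Longrightarrow> p < fib_len (Suc k) \<Longrightarrow> phi ^ (k + 1) \<le> \<bar>real p * phi - of_int P\<bar> \<and>
    (fib_len k < p \<longrightarrow> phi ^ k \<le> \<bar>real p * phi - of_int P\<bar>)" for p P
  proof (induction k arbitrary: p P rule: std_word.induct)
    case 1
    then show ?case by simp
  next
    case 2
    then have p: "p = 1" by simp
    have "1 - phi \<le> \<bar>phi - of_int P\<bar>"
    proof (cases "P \<le> 0")
      case True
      then have "real_of_int P \<le> 0" by simp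
      then show ?thesis using phi_bounds by linarith
    next
      case False
      then have "1 \<le> real_of_int P" by simp
      then show ?thesis by linarith
    qed
    then show ?case using p phi_sq by (simp add: power2_eq_square)
  next
    case (3 k)
    let ?F = "fib_len (Suc (Suc k))"
    obtain Q :: int where Q: "real ?F * phi - Q = - ((- phi) ^ (Suc (Suc k) + 1))"
      using fib_len_phi_int by blast
    have abs: "\<bar>real ?F * phi - Q\<bar> = phi ^ (k + 3)"
      unfolding Q abs_minus_cancel power_abs by (simp add: power_add power3_eq_cube)
    consider "p < ?F" | "p = ?F" | "p > ?F" by linarith
    then show ?case
    proof cases
      case 1
      then have "phi ^ (Suc k + 1) \<le> \<bar>real p * phi - of_int P\<bar>"
        using 3(1)[of p P] 3(3) by simp
      moreover have "phi ^ (Suc (Suc k) + 1) \<le> phi ^ (Suc k + 1)" by (rule phi_power_antimono) simp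
      ultimately show ?thesis using 1 by linarith
    next
      case 2
      have "phi ^ (k + 3) \<le> phi ^ 2" by (rule phi_power_antimono) simp
      \<comment> \<open>Makes Q the nearest integer, so any other P is at distance at least 1 /
        2.\<close>
      then have half: "phi ^ (k + 3) \<le> 1 / 2"
        using phi_bounds phi_sq by (simp add: power2_eq_square)
      have "phi ^ (k + 3) \<le> \<bar>real p * phi - of_int P\<bar>"
      proof (cases "P = Q")
        case True
        then show ?thesis using abs 2 by simp
      next
        case False
        then have "1 \<le> \<bar>Q - P\<bar>" by linarith
        then have "1 \<le> \<bar>real_of_int Q - real_of_int P\<bar>" by (metis of_int_1_le_iff of_int_abs of_int_diff)
        then show ?thesis using abs half unfolding 2 by linarith
      qed
      then show ?thesis using 2 by (simp add: numeral_3_eq_3)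
    next
      case 3
      then have "0 < p - ?F" "p - ?F < fib_len (Suc k)" using "3.prems" by auto
      from "3.IH"(2)[OF this, of "P - Q"]
      have "phi ^ (k + 1) \<le> \<bar>real (p - ?F) * phi - of_int (P - Q)\<bar>" by blast
      also have "real (p - ?F) * phi - of_int (P - Q) = real p * phi - of_int P - (real ?F * phi - Q)"
        using 3 by (simp add: of_nat_diff algebra_simps)
      finally have "phi ^ (k + 1) - phi ^ (k + 3) \<le> \<bar>real p * phi - of_int P\<bar>" using abs by linarith
      then have "phi ^ (k + 2) \<le> \<bar>real p * phi - of_int P\<bar>"
        using phi_power_diff[of "k + 1"] by (simp add: numeral_3_eq_3)
      then have a: "phi ^ Suc (Suc k) \<le> \<bar>real p * phi - of_int P\<bar>" by simp
      have "phi ^ (Suc (Suc k) + 1) \<le> phi ^ Suc (Suc k)" by (rule phi_power_antimono) simp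
      then show ?thesis using a order_trans by blast
    qed
  qed
  from this[OF assms] show "phi ^ (k + 1) \<le> \<bar>real p * phi - of_int P\<bar>"
    and "fib_len k < p \<Longrightarrow> phi ^ k \<le> \<bar>real p * phi - of_int P\<bar>" by blast+
qed

lemma nat_mult_phi_not_Ints: "0 < p \<Longrightarrow> real p * phi \<notin> \<int>"
proof
  assume p: "0 < p" and "real p * phi \<in> \<int>"
  then obtain P :: int where P: "real p * phi = of_int P" by (auto elim: Ints_cases)
  have "p < fib_len (Suc p)" using fib_len_ge[of "Suc p"] by simp
  then show False using best_approx(1)[OF p, of p P] P zero_less_power[OF phi_pos, of "p + 1"]
    by (metis abs_zero cancel_comm_monoid_add_class.diff_cancel not_le)
qed

lemma phi_irrational: "phi \<notin> \<rat>"
proof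
  assume "phi \<in> \<rat>"
  then obtain m n :: int where mn: "phi = of_int m / of_int n" "0 < n"
    by (auto elim: Rats_cases')
  then have "real (nat n) * phi = of_int m" by (simp add: field_simps)
  then show False using nat_mult_phi_not_Ints[of "nat n"] mn(2) by auto
qed

section \<open>Repetitions\<close>

text \<open>The point coded by the n-th shift of x: the letters read so far account for the integer
  part of the rotated point.\<close>

definition orbit :: "real \<Rightarrow> nat stream \<Rightarrow> nat \<Rightarrow> real" where
  "orbit \<alpha> x n = \<alpha> + real n * phi - (\<Sum>i<n. real (x !! i))"

lemma codes_orbit: "codes \<alpha> x \<Longrightarrow> codes (orbit \<alpha> x n) (sdrop n x)"
proof (induction n)
  case 0
  then show ?case by (simp add: orbit_def)
next
  case (Suc n)
  then show ?case using codes_stl[of "orbit \<alpha> x n" "sdrop n x"]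
    by (simp add: orbit_def algebra_simps)
qed

lemma orbit_bounds: "codes \<alpha> x \<Longrightarrow> 0 \<le> orbit \<alpha> x n \<and> orbit \<alpha> x n \<le> 1"
  using codes_orbit codes_bounds by blast

lemma orbit_add: "orbit \<alpha> x (t + q) = orbit \<alpha> x t + real q * phi - (\<Sum>i<q. real (x !! (t + i)))"
  by (induction q) (simp_all add: orbit_def algebra_simps)

lemma orbit_add_int: "\<exists>z::int. orbit \<alpha> x (t + q) - orbit \<alpha> x t = real q * phi - of_int z"
  unfolding orbit_add by (intro exI[of _ "int (\<Sum>i<q. x !! (t + i))"]) simp

text \<open>0 and 1 are the same point of the circle, which an irrational rotation visits at most
  once. This rules out the boundary case in \<open>no_long_window\<close>.\<close>

lemma orbit_not_0_1:
  assumes "orbit \<alpha> x s = 0" shows "orbit \<alpha> x t \<noteq> 1"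
proof
  assume 1: "orbit \<alpha> x t = 1"
  consider "s = t" | q where "t = s + q" "0 < q" | q where "s = t + q" "0 < q"
    by (metis less_imp_add_positive linorder_neqE_nat)
  then show False
  proof cases
    case (2 q)
    then obtain z :: int where "real q * phi - z = 1" using orbit_add_int[of \<alpha> x s q] assms 1 by auto
    then have "real q * phi = of_int (z + 1)" by simp
    then show False using nat_mult_phi_not_Ints[OF 2(2)] by simp
  next
    case (3 q)
    then obtain z :: int where "real q * phi - z = -1" using orbit_add_int[of \<alpha> x t q] assms 1 by auto
    then have "real q * phi = of_int (z - 1)" by simp
    then show False using nat_mult_phi_not_Ints[OF 3(2)] by simp
  qed (use assms 1 in simp)
qed

text \<open>The values of \<open>f\<close> at \<open>i, \<dots>, i + n\<close> stay below \<open>1 - \<delta>\<close>, but from the largest of them one of the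
  steps \<open>a\<close> (forwards) or \<open>b\<close> (backwards) stays in this range and leads to a larger value.\<close>

lemma no_long_window:
  fixes f :: "nat \<Rightarrow> real"
  assumes f01: "\<And>t. 0 \<le> f t \<and> f t \<le> 1" and no01: "\<And>s t. f s = 0 \<Longrightarrow> f t \<noteq> 1"
    and a: "\<And>t. f (t + a) - f t - \<eta> \<in> \<int>" "0 < \<eta>" "\<eta> \<le> \<delta>"
    and b: "\<And>t. f (t + b) - f t + \<kappa> \<in> \<int>" "0 < \<kappa>" "\<kappa> \<le> \<delta>"
    and shift: "\<And>t. i \<le> t \<Longrightarrow> t \<le> i + n \<Longrightarrow> f (t + p) = f t + \<delta>"
  shows "n + 1 < a + b"
proof (rule ccontr)
  assume long: "\<not> n + 1 < a + b"
  have "finite (f ` {i..i + n})" "f ` {i..i + n} \<noteq> {}" by auto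
  from Max_in[OF this] obtain t where "t \<in> {i..i + n}" "f t = Max (f ` {i..i + n})"
    by (metis imageE)
  then have t: "i \<le> t" "t \<le> i + n" "f t = Max (f ` {i..i + n})" by auto
  have max: "f s \<le> f t" if "i \<le> s" "s \<le> i + n" for s
    unfolding t(3) using that by (intro Max_ge) auto
  have "\<exists>s \<zeta>. i \<le> s \<and> s \<le> i + n \<and> 0 < \<zeta> \<and> \<zeta> \<le> \<delta> \<and> f s - f t - \<zeta> \<in> \<int>"
  proof (cases "t + a \<le> i + n")
    case True
    then show ?thesis using t(1,2) a by (intro exI[of _ "t + a"] exI[of _ \<eta>]) auto
  next
    case False
    \<comment> \<open>As n + 1 is at least a + b, a point too late for the forward step is late
      enough for the backward one.\<close>
    then have "i + b \<le> t" using long t by linarith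
    moreover from this have "f (t - b) - f t - \<kappa> = - (f (t - b + b) - f (t - b) + \<kappa>)" by simp
    then have "f (t - b) - f t - \<kappa> \<in> \<int>" using b(1)[of "t - b"] Ints_minus by metis
    ultimately show ?thesis using t b(2,3) by (intro exI[of _ "t - b"] exI[of _ \<kappa>]) auto
  qed
  then obtain s \<zeta> where s: "i \<le> s" "s \<le> i + n" "0 < \<zeta>" "\<zeta> \<le> \<delta>" "f s - f t - \<zeta> \<in> \<int>" by blast
  then obtain z :: int where z: "f s - f t - \<zeta> = of_int z" by (auto elim: Ints_cases)
  have top: "f t + \<delta> \<le> 1" "f (t + p) = f t + \<delta>" using shift[OF t(1,2)] f01[of "t + p"] by auto
  \<comment> \<open>With z at most -1, f s is at most f t + \<open>\<delta>\<close> - 1, which is at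
    most 0. Equality holds throughout, so f takes both values 0 and 1.\<close>
  have "z < 0" using max[OF s(1,2)] s(3) z by linarith
  then have "real_of_int z \<le> -1" by simp
  then have "f s = 0" "f (t + p) = 1" using z top f01[of s] f01[of t] s(4) by linarith+
  then show False using no01 by blast
qed

definition repeats :: "'a stream \<Rightarrow> nat \<Rightarrow> nat \<Rightarrow> nat \<Rightarrow> bool" where
  "repeats x i p n \<longleftrightarrow> 0 < p \<and> (\<forall>t<n. x !! (i + t) = x !! (i + p + t))"

lemma repeats_orbit:
  assumes "repeats x i p n" "i \<le> t" "t \<le> i + n"
  shows "orbit \<alpha> x (t + p) = orbit \<alpha> x t + (orbit \<alpha> x (i + p) - orbit \<alpha> x i)"
proof -
  have "s \<le> n \<Longrightarrow> orbit \<alpha> x (i + p + s) - orbit \<alpha> x (i + s) = orbit \<alpha> x (i + p) - orbit \<alpha> x i" for s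
    using assms(1) by (induction s) (auto simp: repeats_def orbit_def algebra_simps)
  from this[of "t - i"] show ?thesis using assms by (simp add: add.commute algebra_simps)
qed

text \<open>Modulo 1, the shifts by F(k) and F(k+1) move the orbit by phi^(k+1) and phi^(k+2) with
  opposite signs, so they serve as the steps of \<open>no_long_window\<close>. The four cases are
  the parity of k and the sign of \<open>\<delta>\<close>; a negative one is handled by reflecting f
  to 1 - f.\<close>

lemma repeats_short:
  assumes x: "codes \<alpha> x" and rep: "repeats x i p n"
    and large: "phi ^ Suc k \<le> \<bar>orbit \<alpha> x (i + p) - orbit \<alpha> x i\<bar>"
  shows "n + 1 < fib_len (Suc (Suc k))"
proof -
  let ?f = "orbit \<alpha> x"
  define \<delta> where "\<delta> = ?f (i + p) - ?f i"
  define e where "e j = - ((- phi) ^ (j + 1))" for j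
  have step: "?f (t + fib_len j) - ?f t - e j \<in> \<int>" for t j
  proof -
    obtain P :: int where "real (fib_len j) * phi - P = e j" using fib_len_phi_int e_def by auto
    moreover obtain z :: int where "?f (t + fib_len j) - ?f t = real (fib_len j) * phi - z"
      using orbit_add_int by blast
    ultimately have "?f (t + fib_len j) - ?f t - e j = of_int (P - z)" by simp
    then show ?thesis by (metis Ints_of_int)
  qed
  have step': "(1 - ?f (t + fib_len j)) - (1 - ?f t) + e j \<in> \<int>" for t j
    using Ints_minus[OF step[of t j]] by (simp add: algebra_simps)
  have pos: "0 < phi ^ m" for m by simp
  have m: "phi ^ (k + 2) \<le> phi ^ Suc k" by (rule phi_power_antimono) simp
  have \<delta>: "phi ^ Suc k \<le> \<bar>\<delta>\<bar>" "phi ^ (k + 2) \<le> \<bar>\<delta>\<bar>" using large m unfolding \<delta>_def by linarith+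
  have sh: "?f (t + p) = ?f t + \<delta>" if "i \<le> t" "t \<le> i + n" for t
    unfolding \<delta>_def using repeats_orbit[OF rep that] .
  have no01: "1 - ?f t \<noteq> 1" if "1 - ?f s = 0" for s t using orbit_not_0_1[of \<alpha> x t s] that by auto
  have "e (Suc k) = - (phi ^ (k + 2)) \<and> e k = phi ^ Suc k \<and> even k \<or>
    e (Suc k) = phi ^ (k + 2) \<and> e k = - (phi ^ Suc k) \<and> odd k"
    unfolding e_def by (cases "even k") (simp_all add: power_minus_even power_minus_odd)
  moreover have "\<delta> > 0 \<or> \<delta> < 0" using \<delta> pos[of "Suc k"] by linarith
  ultimately consider (1) "\<delta> > 0" "e (Suc k) = phi ^ (k + 2)" "e k = - (phi ^ Suc k)"
    | (2) "\<delta> < 0" "e (Suc k) = - (phi ^ (k + 2))" "e k = phi ^ Suc k"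
    | (3) "\<delta> > 0" "e (Suc k) = - (phi ^ (k + 2))" "e k = phi ^ Suc k"
    | (4) "\<delta> < 0" "e (Suc k) = phi ^ (k + 2)" "e k = - (phi ^ Suc k)" by blast
  then have "n + 1 < fib_len (Suc k) + fib_len k"
  proof cases
    case 1
    show ?thesis
      by (rule no_long_window[of ?f "fib_len (Suc k)" "phi ^ (k + 2)" \<delta> "fib_len k" "phi ^ Suc k" i n p])
        (use 1 \<delta> step[of _ "Suc k"] step[of _ k] sh orbit_bounds[OF x] orbit_not_0_1 in auto)
  next
    case 2
    show ?thesis
      by (rule no_long_window[of "\<lambda>t. 1 - ?f t" "fib_len (Suc k)" "phi ^ (k + 2)" "- \<delta>" "fib_len k" "phi ^ Suc k" i n p])
        (use 2 \<delta> step'[of _ "Suc k"] step'[of _ k] sh orbit_bounds[OF x] no01 in auto)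
  next
    case 3
    have "n + 1 < fib_len k + fib_len (Suc k)"
      by (rule no_long_window[of ?f "fib_len k" "phi ^ Suc k" \<delta> "fib_len (Suc k)" "phi ^ (k + 2)" i n p])
        (use 3 \<delta> step[of _ "Suc k"] step[of _ k] sh orbit_bounds[OF x] orbit_not_0_1 in auto)
    then show ?thesis by simp
  next
    case 4
    have "n + 1 < fib_len k + fib_len (Suc k)"
      by (rule no_long_window[of "\<lambda>t. 1 - ?f t" "fib_len k" "phi ^ Suc k" "- \<delta>" "fib_len (Suc k)" "phi ^ (k + 2)" i n p])
        (use 4 \<delta> step'[of _ "Suc k"] step'[of _ k] sh orbit_bounds[OF x] no01 in auto)
    then show ?thesis by simp
  qed
  then show ?thesis by simp
qed

text \<open>A period p displaces the orbit at least by the distance of p phi to the integers.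
  Strictly between Fibonacci lengths the bound on n is one Fibonacci number smaller, which is why
  only the periods F(k) give ratios below phi in the limit.\<close>

lemma repeats_length:
  assumes "codes \<alpha> x" "repeats x i p n" "fib_len k \<le> p" "p < fib_len (Suc k)"
  shows "n + 1 < fib_len (Suc (Suc k))" "fib_len k < p \<Longrightarrow> n + 1 < fib_len (Suc k)"
proof -
  obtain z :: int where z: "orbit \<alpha> x (i + p) - orbit \<alpha> x i = real p * phi - z"
    using orbit_add_int by blast
  have p: "0 < p" using assms(2) by (simp add: repeats_def)
  then obtain m where m: "k = Suc m" using assms(4) by (cases k) auto
  show "n + 1 < fib_len (Suc (Suc k))"
    using repeats_short[OF assms(1,2), of k] best_approx(1)[OF p assms(4), of z] z by simp
  show "n + 1 < fib_len (Suc k)" if "fib_len k < p"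
    using repeats_short[OF assms(1,2), of m] best_approx(2)[OF p assms(4) that, of z] z m by simp
qed

section \<open>The exponent of repetition in terms of starts and periods of repetitions\<close>

lemma rep_fun_le:
  assumes "repeats x i p n"
  shows "rep_fun n x \<le> i + p + n"
  unfolding rep_fun_def
proof (rule Least_le, intro exI[of _ "Suc i"] conjI)
  have "stake n (sdrop i x) = stake n (sdrop (i + p) x)"
    using assms by (intro nth_equalityI) (auto simp: repeats_def sdrop_snth)
  then show "factor_at x (Suc i) n = factor_at x (i + p + n - n + 1) n"
    by (simp add: factor_at_def)
qed (use assms in \<open>auto simp: repeats_def\<close>)

text \<open>Some factor of length n recurs by the pigeonhole principle, so the minimum in
  \<open>rep_fun\<close> is attained.\<close>

lemma rep_fun_repeats:
  assumes "finite (sset x)"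
  shows "\<exists>i p. repeats x i p n \<and> rep_fun n x = i + p + n"
proof -
  let ?P = "\<lambda>m. \<exists>j\<ge>1. j + n \<le> m \<and> factor_at x j n = factor_at x (m - n + 1) n"
  have "\<not> inj (\<lambda>i. stake n (sdrop i x))"
  proof
    assume "inj (\<lambda>i. stake n (sdrop i x))"
    moreover have "range (\<lambda>i. stake n (sdrop i x)) \<subseteq> {w. set w \<subseteq> sset x \<and> length w = n}"
      by (auto simp: set_conv_nth sdrop_snth)
    ultimately have "finite (UNIV :: nat set)"
      using finite_imageD[OF finite_subset[OF _ finite_lists_length_eq[OF assms, of n]]] by blast
    then show False by simp
  qed
  then obtain s t where "s < t" "stake n (sdrop s x) = stake n (sdrop t x)"
    unfolding inj_def by (metis linorder_neqE_nat)
  then have "?P (t + n)" by (intro exI[of _ "Suc s"]) (simp add: factor_at_def)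
  then have "?P (rep_fun n x)" unfolding rep_fun_def by (rule LeastI)
  then obtain j where j: "j \<ge> 1" "j + n \<le> rep_fun n x"
    "factor_at x j n = factor_at x (rep_fun n x - n + 1) n" by blast
  define p where "p = rep_fun n x - n - (j - 1)"
  have p: "0 < p" "rep_fun n x = (j - 1) + p + n" using j unfolding p_def by auto
  then have "rep_fun n x - n + 1 - 1 = j - 1 + p" by simp
  then have e: "stake n (sdrop (j - 1) x) = stake n (sdrop (j - 1 + p) x)"
    using j(3) unfolding factor_at_def by metis
  have "x !! (j - 1 + t) = x !! (j - 1 + p + t)" if "t < n" for t
    using arg_cong[OF e, of "\<lambda>w. w ! t"] that by (simp add: sdrop_snth)
  then show ?thesis using p by (intro exI[of _ "j - 1"] exI[of _ p]) (simp add: repeats_def)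
qed

lemma rep_gtD:
  assumes "ereal (1 + c) < rep x"
  shows "\<exists>N. \<forall>n\<ge>N. \<forall>i p. repeats x i p n \<longrightarrow> c * real n < real (i + p)"
proof -
  obtain N where N: "\<And>n. n \<ge> N \<Longrightarrow> 1 + c < real (rep_fun n x) / real n"
    using less_LiminfD[OF assms[unfolded rep_def]] by (auto simp: eventually_sequentially)
  have "c * real n < real (i + p)" if "n \<ge> Suc N" "repeats x i p n" for n i p
  proof -
    have "(1 + c) * real n < real (rep_fun n x)" using N[of n] that(1) by (simp add: field_simps)
    also have "\<dots> \<le> real (i + p + n)" using rep_fun_le[OF that(2)] by (rule of_nat_mono)
    finally show ?thesis by (simp add: algebra_simps)
  qed
  then show ?thesis by blast
qed

lemma rep_geI:
  assumes "finite (sset x)" "\<And>n i p. n \<ge> N \<Longrightarrow> repeats x i p n \<Longrightarrow> c * real n \<le> real (i + p)"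
  shows "ereal (1 + c) \<le> rep x"
  unfolding rep_def
proof (rule Liminf_bounded, unfold eventually_sequentially, intro exI allI impI)
  fix n assume n: "Suc N \<le> n"
  obtain i p where ip: "repeats x i p n" "rep_fun n x = i + p + n"
    using rep_fun_repeats[OF assms(1)] by blast
  have "(1 + c) * real n \<le> real (rep_fun n x)" using assms(2)[OF _ ip(1)] n ip(2) by (simp add: algebra_simps)
  then show "ereal (1 + c) \<le> ereal (real (rep_fun n x) / real n)" using n by (simp add: field_simps)
qed

lemma repeatsI:
  assumes "x = A @- Q @- y" "x = (A @ B) @- Q @- z" "B \<noteq> []"
  shows "repeats x (length A) (length B) (length Q)"
proof -
  have "x !! (length A + t) = Q ! t" if "t < length Q" for t
    using that by (subst assms(1)) simp
  moreover have "x !! (length A + length B + t) = Q ! t" if "t < length Q" for t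
    using that by (subst assms(2)) (simp del: shift_append)
  ultimately show ?thesis using assms(3) by (auto simp: repeats_def)
qed

lemma repeats_mismatch:
  assumes "repeats x i p n" "x !! h \<noteq> x !! (h + p)" "i \<le> h"
  shows "n \<le> h - i"
proof (rule ccontr)
  assume "\<not> n \<le> h - i"
  then have "x !! (i + (h - i)) = x !! (i + p + (h - i))" using assms(1) by (simp add: repeats_def)
  then show False using assms(2,3) by (simp add: add.commute add.left_commute)
qed

lemma snth_shift_mid: "x = A @- a ## y \<Longrightarrow> x !! length A = a"
  by simp

lemma std_word_trunc_Suc: "std_word_trunc (Suc (Suc j)) = std_word (Suc j) @ std_word_trunc (Suc j)"
proof -
  obtain a b where ab: "std_word j @ std_word (Suc j) = std_word_trunc (Suc j) @ [b, a]"
    using std_word_swap[of j] by blast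
  obtain c d where cd: "std_word (Suc (Suc j)) @ std_word (Suc j) = std_word_trunc (Suc (Suc j)) @ [c, d]"
    using std_word_swap[of "Suc j"] by blast
  have "std_word_trunc (Suc (Suc j)) @ [c, d] = (std_word (Suc j) @ std_word_trunc (Suc j)) @ [b, a]"
    unfolding cd[symmetric] std_word.simps(3) append.assoc ab ..
  then show ?thesis by simp
qed

text \<open>The equation says that the truncated word u has period \<open>fib_len (Suc j)\<close>.
  It holds because u begins with \<open>std_word j\<close>, and
  \<open>std_word (Suc j) @ std_word j\<close> begins with u.\<close>

lemma std_word_trunc_period: "\<exists>c. std_word (Suc j) @ std_word_trunc (Suc j) = std_word_trunc (Suc j) @ c"
proof (cases j)
  case 0
  then show ?thesis by (simp add: std_word_trunc_def)
next
  case (Suc i)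
  obtain a b where ab: "std_word (Suc j) @ std_word j = std_word_trunc (Suc j) @ [a, b]"
    using std_word_swap[of j] by blast
  have u: "std_word_trunc (Suc j) = std_word j @ std_word_trunc j"
    unfolding Suc by (rule std_word_trunc_Suc)
  have "std_word (Suc j) @ std_word_trunc (Suc j) = (std_word (Suc j) @ std_word j) @ std_word_trunc j"
    unfolding u append.assoc ..
  also have "\<dots> = std_word_trunc (Suc j) @ ([a, b] @ std_word_trunc j)"
    unfolding ab append.assoc ..
  finally show ?thesis by blast
qed

section \<open>Repetitions and mismatches forced by the chain\<close>

context
  fixes \<alpha> :: real and x :: "nat stream"
  assumes codes: "codes \<alpha> x"
begin

lemma located_loc_word: "located (Suc j) (chain_sym j x) (loc_word j x) x"
  using located_Suc_iff[OF codes] by blast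

lemma loc_word_shape:
  obtains V y where "loc_home j (chain_sym j x) = V @ loc_word j x"
    "x = loc_word j x @- loc_sep j (chain_sym j x) @- std_word (Suc j) @- std_word_trunc (Suc j) @- y"
  using located_loc_word[of j] unfolding located_iff suffix_def shift_append by blast

text \<open>Let M = V W and let u be the truncated word. Then x starts with W V W u, and by the
  period of u also with W u; so W u occurs at 0 and again after |W V| = |M| letters.\<close>

lemma repeats_i:
  assumes "chain_sym j x = Loc_i"
  shows "repeats x 0 (fib_len (Suc j)) (loc_len j x + fib_len (Suc (Suc j)) - 2)"
proof -
  let ?W = "loc_word j x" and ?u = "std_word_trunc (Suc j)"
  obtain V y where V: "std_word (Suc j) = V @ ?W"
    and x: "x = ?W @- std_word (Suc j) @- ?u @- y"
    using loc_word_shape[of j] assms by (auto simp: loc_home_def loc_sep_def)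
  obtain c where c: "std_word (Suc j) @ ?u = ?u @ c" using std_word_trunc_period by blast
  have "x = ?W @- (std_word (Suc j) @ ?u) @- y" by (subst x) simp
  also have "\<dots> = [] @- (?W @ ?u) @- c @- y" unfolding c by simp
  finally have 1: "x = [] @- (?W @ ?u) @- c @- y" .
  have 2: "x = ([] @ ?W @ V) @- (?W @ ?u) @- y" by (subst x, subst V) simp
  have "repeats x (length ([] :: nat list)) (length (?W @ V)) (length (?W @ ?u))"
    using repeatsI[OF 1 2] loc_word_not_Nil[OF codes] by simp
  moreover have "length (?W @ V) = fib_len (Suc j)" using arg_cong[OF V, of length] by (simp add: fib_len_def)
  moreover have "length (?W @ ?u) = loc_len j x + fib_len (Suc (Suc j)) - 2"
    using length_std_word_trunc[of j] by (simp add: loc_len_def)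
  ultimately show ?thesis by simp
qed

text \<open>W is the same at both levels. With M' = \<open>std_word j\<close>, x starts with W M (M
  M') (M u). The swap of M M' and M' M shows M u directly after W and directly after W M.\<close>

lemma repeats_iii_ii:
  assumes "chain_sym j x = Loc_iii" "chain_sym (Suc j) x = Loc_ii"
  shows "repeats x (loc_len j x) (fib_len (Suc j)) (fib_len (Suc (Suc (Suc j))) - 2)"
proof -
  let ?W = "loc_word j x" and ?u = "std_word_trunc (Suc j)" and ?M = "std_word (Suc j)"
  have W: "loc_word (Suc j) x = ?W" using loc_word_Suc[OF codes, of j] assms(1) by (simp add: loc_sep_def)
  obtain y where x: "x = ?W @- ?M @- std_word (Suc (Suc j)) @- std_word_trunc (Suc (Suc j)) @- y"
    using loc_word_shape[of "Suc j"] assms(2) unfolding W by (auto simp: loc_sep_def)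
  obtain a b where ab: "?M @ std_word j = ?u @ [a, b]" "std_word j @ ?M = ?u @ [b, a]"
    using std_word_swap[of j] by blast
  have "x = ?W @- ?M @- (?M @ std_word j) @- std_word_trunc (Suc (Suc j)) @- y"
    by (subst x) simp
  then have 1: "x = ?W @- (?M @ ?u) @- [a, b] @- std_word_trunc (Suc (Suc j)) @- y"
    unfolding ab by (simp only: shift_append)
  have "x = ?W @- ?M @- ?M @- (std_word j @ ?M) @- ?u @- y"
    by (subst x) (simp add: std_word_trunc_Suc)
  then have 2: "x = (?W @ ?M) @- (?M @ ?u) @- [b, a] @- ?u @- y"
    unfolding ab by (simp only: shift_append)
  have "length (?M @ ?u) = fib_len (Suc (Suc (Suc j))) - 2"
    using length_std_word_trunc[of j] by (simp add: fib_len_def)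
  then show ?thesis using repeatsI[OF 1 2] by (simp add: loc_len_def fib_len_def)
qed

text \<open>Here x starts with W M M' M u. Grouped as W (M M') and as W M (M' M), it shows u after W
  and after W M, followed by the two different letters of the swap.\<close>

lemma mismatch_next:
  assumes "chain_sym j x \<noteq> Loc_ii" "chain_sym (Suc j) x \<noteq> Loc_ii"
  shows "x !! (loc_len j x + fib_len (Suc (Suc j)) - 2) \<noteq>
    x !! (loc_len j x + fib_len (Suc (Suc j)) - 2 + fib_len (Suc j))"
proof -
  let ?W = "loc_word j x" and ?u = "std_word_trunc (Suc j)" and ?M = "std_word (Suc j)"
  have W: "loc_word (Suc j) x = ?W" using loc_word_Suc[OF codes, of j] assms(1) by (simp add: loc_sep_def)
  obtain y where x: "x = ?W @- std_word (Suc (Suc j)) @- std_word_trunc (Suc (Suc j)) @- y"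
    using loc_word_shape[of "Suc j"] assms(2) unfolding W by (auto simp: loc_sep_def)
  obtain a b where ab: "a \<noteq> b" "?M @ std_word j = ?u @ [a, b]" "std_word j @ ?M = ?u @ [b, a]"
    using std_word_swap[of j] by blast
  have "x = ?W @- (?M @ std_word j) @- std_word_trunc (Suc (Suc j)) @- y" by (subst x) simp
  then have 1: "x = (?W @ ?u) @- a ## b ## std_word_trunc (Suc (Suc j)) @- y"
    unfolding ab by (simp only: shift_append shift.simps)
  have "x = ?W @- ?M @- (std_word j @ ?M) @- ?u @- y"
    by (subst x) (simp add: std_word_trunc_Suc)
  then have 2: "x = (?W @ ?M @ ?u) @- b ## a ## ?u @- y"
    unfolding ab by (simp only: shift_append shift.simps)
  have "length (?W @ ?u) = loc_len j x + fib_len (Suc (Suc j)) - 2"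
    "length (?W @ ?M @ ?u) = loc_len j x + fib_len (Suc (Suc j)) - 2 + fib_len (Suc j)"
    using length_std_word_trunc[of j] by (simp_all add: loc_len_def fib_len_def)
  then show ?thesis using snth_shift_mid[OF 1] snth_shift_mid[OF 2] ab(1) by metis
qed

lemma loc_len_pos: "0 < loc_len j x"
  using loc_word_not_Nil[OF codes] by (simp add: loc_len_def)

lemma mismatch_ii:
  assumes "chain_sym j x = Loc_ii"
  shows "x !! (loc_len j x + fib_len j - 2) \<noteq> x !! (loc_len j x + fib_len j - 2 + fib_len (Suc j))"
proof -
  let ?W = "loc_word j x" and ?u = "std_word_trunc (Suc j)" and ?M = "std_word (Suc j)"
  obtain V y where V: "?M = V @ ?W" and x: "x = ?W @- std_word j @- ?M @- ?u @- y"
    using loc_word_shape[of j] assms by (auto simp: loc_home_def loc_sep_def)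
  obtain a b where ab: "a \<noteq> b" "?M @ std_word j = ?u @ [a, b]" "std_word j @ ?M = ?u @ [b, a]"
    using std_word_swap[of j] by blast
  \<comment> \<open>Completing W to M by the prefix V makes the swap visible; the length of V is
    subtracted at the end.\<close>
  have Vx: "V @- x = ?M @- std_word j @- ?M @- ?u @- y" proof -
    have "V @- x = (V @ ?W) @- std_word j @- ?M @- ?u @- y" by (subst x) simp
    then show ?thesis unfolding V[symmetric] .
  qed
  then have "V @- x = (?M @ std_word j) @- ?M @- ?u @- y" by simp
  then have 1: "V @- x = ?u @- a ## b ## ?M @- ?u @- y"
    unfolding ab by (simp only: shift_append shift.simps)
  have "V @- x = ?M @- (std_word j @ ?M) @- ?u @- y" using Vx by simp
  then have 2: "V @- x = (?M @ ?u) @- b ## a ## ?u @- y"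
    unfolding ab by (simp only: shift_append shift.simps)
  have len: "length V + loc_len j x = fib_len (Suc j)" using arg_cong[OF V, of length]
    by (simp add: loc_len_def fib_len_def)
  have "length ?u = length V + (loc_len j x + fib_len j - 2)"
    "length (?M @ ?u) = length V + (loc_len j x + fib_len j - 2 + fib_len (Suc j))"
    using len length_std_word_trunc[of j] fib_len_pos[of j] loc_len_pos[of j] fib_len_simps(3)[of j]
    unfolding length_append fib_len_def[of "Suc j", symmetric] by linarith+
  then show ?thesis using snth_shift_mid[OF 1] snth_shift_mid[OF 2] ab(1)
    by (metis add_diff_cancel_left' le_add1 shift_snth_ge)
qed

text \<open>W ends like \<open>std_word j\<close>, whose last letter differs from that of
  \<open>std_word (Suc j)\<close> by the swap.\<close>

lemma mismatch_iii:
  assumes "chain_sym j x = Loc_iii"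
  shows "x !! (loc_len j x - 1) \<noteq> x !! (loc_len j x - 1 + fib_len (Suc j))"
proof -
  let ?W = "loc_word j x" and ?u = "std_word_trunc (Suc j)" and ?M = "std_word (Suc j)"
  obtain V y where V: "std_word j = V @ ?W" and x: "x = ?W @- ?M @- ?u @- y"
    using loc_word_shape[of j] assms by (auto simp: loc_home_def loc_sep_def)
  obtain a b where ab: "a \<noteq> b" "?M @ std_word j = ?u @ [a, b]" "std_word j @ ?M = ?u @ [b, a]"
    using std_word_swap[of j] by blast
  have W: "?W \<noteq> []" by (rule loc_word_not_Nil[OF codes])
  have lastW: "last ?W = b" using arg_cong[OF ab(2), of last] V W by simp
  have lastM: "last ?M = a" using arg_cong[OF ab(3), of last] by (simp del: std_word.simps)
  have 1: "x = butlast ?W @- last ?W ## ?M @- ?u @- y"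
    by (subst x, subst (1) append_butlast_last_id[OF W, symmetric]) (simp only: shift_append shift.simps)
  have 2: "x = (?W @ butlast ?M) @- last ?M ## ?u @- y"
    by (subst x, subst (1) append_butlast_last_id[OF std_word_not_Nil, symmetric]) (simp only: shift_append shift.simps)
  have "length (butlast ?W) = loc_len j x - 1"
    "length (?W @ butlast ?M) = loc_len j x - 1 + fib_len (Suc j)"
    using loc_len_pos[of j] fib_len_pos[of "Suc j"]
    unfolding loc_len_def fib_len_def length_append length_butlast by linarith+
  then show ?thesis using snth_shift_mid[OF 1] snth_shift_mid[OF 2] ab(1) lastW lastM by metis
qed

text \<open>A mismatch at distance p caps n for every start before it, and a start after it makes i
  + p large. What is left over are the two ratios in \<open>ci\<close> and
  \<open>ciii\<close>.\<close>

lemma repeats_ratio_ge: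
  fixes c :: real
  assumes rep: "repeats x i p n" and p: "fib_len (Suc j) \<le> p" "p < fib_len (Suc (Suc j))"
    and c: "0 < c" "c \<le> 1"
    and c1: "c * fib_len (Suc (Suc j)) \<le> fib_len (Suc j)"
    and c2: "c * fib_len (Suc (Suc (Suc j))) \<le> fib_len (Suc (Suc j))"
    and ci: "chain_sym j x = Loc_i \<Longrightarrow> c * (loc_len j x + fib_len (Suc (Suc j))) \<le> fib_len (Suc j)"
    and ciii: "chain_sym j x = Loc_iii \<Longrightarrow> chain_sym (Suc j) x = Loc_ii \<Longrightarrow>
      c * fib_len (Suc (Suc (Suc j))) \<le> fib_len (Suc j) + loc_len j x"
  shows "c * n \<le> i + p"
proof -
  let ?w = "loc_len j x"
  have bound: "c * n \<le> i + p" if "n \<le> m" "c * real m \<le> i + p" for m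
  proof -
    have "c * n \<le> c * m" using that(1) c(1) by simp
    then show ?thesis using that(2) by linarith
  qed
  have direct: "c * n \<le> i + p" if "n \<le> i + p"
  proof -
    have "c * n \<le> 1 * real n" using c(2) by (intro mult_right_mono) auto
    then show ?thesis using that by linarith
  qed
  have w: "?w \<le> fib_len (Suc j)" "0 < ?w" using loc_len_le[OF codes] loc_len_pos by auto
  show ?thesis
  proof (cases "p = fib_len (Suc j)")
    case False
    then have "n + 1 < fib_len (Suc (Suc j))" using repeats_length(2)[OF codes rep p] p by simp
    then show ?thesis using c1 p by (intro bound[of "fib_len (Suc (Suc j))"]) linarith+
  next
    case True
    have n: "n + 1 < fib_len (Suc (Suc (Suc j)))" using repeats_length(1)[OF codes rep p] .
    have F3: "fib_len (Suc (Suc (Suc j))) = fib_len (Suc (Suc j)) + fib_len (Suc j)" by simp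
    note mm = repeats_mismatch[OF rep, unfolded True]
    \<comment> \<open>Here i + p is already at least F(j+3), which exceeds n.\<close>
    have late: ?thesis if "?w + fib_len (Suc (Suc j)) - 2 < i"
      using that n F3 True w(2) by (intro direct) linarith
    show ?thesis
    proof (cases "chain_sym j x")
      case Loc_i
      have "chain_sym (Suc j) x = Loc_iii" using sym_i_iii[OF codes Loc_i] .
      then have m: "x !! (?w + fib_len (Suc (Suc j)) - 2) \<noteq> x !! (?w + fib_len (Suc (Suc j)) - 2 + fib_len (Suc j))"
        using mismatch_next[of j] Loc_i by simp
      show ?thesis
      proof (cases "i \<le> ?w + fib_len (Suc (Suc j)) - 2")
        case True': True
        then have "n \<le> ?w + fib_len (Suc (Suc j))" using mm[OF m] by linarith
        then show ?thesis using ci[OF Loc_i] True by (intro bound) (auto simp del: fib_len_simps)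
      qed (use late in linarith)
    next
      case Loc_ii
      show ?thesis
      proof (cases "i \<le> ?w + fib_len j - 2")
        case True': True
        then have "n \<le> ?w + fib_len j" using mm[OF mismatch_ii[OF Loc_ii]] by linarith
        then have "n \<le> fib_len (Suc (Suc j))" using w(1) by simp
        then show ?thesis using c1 True by (intro bound) (auto simp del: fib_len_simps)
      next
        case False
        then have "fib_len (Suc (Suc j)) \<le> i + p" using True w(2) by simp
        then show ?thesis using c2 n by (intro bound[of "fib_len (Suc (Suc (Suc j)))"]) linarith+
      qed
    next
      case Loc_iii
      have short: ?thesis if "n \<le> fib_len (Suc (Suc j))"
        using that c1 True by (intro bound) (auto simp del: fib_len_simps)
      show ?thesis
      proof (cases "i \<le> ?w - 1")
        case True': True
        then have "n \<le> ?w" using mm[OF mismatch_iii[OF Loc_iii]] by linarith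
        then show ?thesis using w(1) fib_len_mono[of "Suc j" "Suc (Suc j)"] by (intro short) linarith
      next
        case False
        show ?thesis
        proof (cases "chain_sym (Suc j) x = Loc_ii")
          case True': True
          have "?w \<le> i" using False w by linarith
          then show ?thesis using ciii[OF Loc_iii True'] n True
            by (intro bound[of "fib_len (Suc (Suc (Suc j)))"]) linarith+
        next
          case no_ii: False
          show ?thesis
          proof (cases "i \<le> ?w + fib_len (Suc (Suc j)) - 2")
            case True': True
            then have "n \<le> ?w + fib_len (Suc (Suc j)) - 2 - i"
              using mm[OF mismatch_next[OF _ no_ii]] Loc_iii by simp
            then show ?thesis using False by (intro short) linarith
          qed (use late in linarith)
        qed
      qed
    qed
  qed
qed

lemma finite_letters: "finite (sset x)"
  using codes_sset[OF codes] finite_subset by blast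

lemma rep_lower:
  fixes c :: real
  assumes c: "0 < c" "c \<le> 1"
    and K: "\<And>j. K \<le> j \<Longrightarrow> c * fib_len (Suc j) \<le> fib_len j"
      "\<And>j. K \<le> j \<Longrightarrow> chain_sym j x = Loc_i \<Longrightarrow> c * (loc_len j x + fib_len (Suc (Suc j))) \<le> fib_len (Suc j)"
      "\<And>j. K \<le> j \<Longrightarrow> chain_sym j x = Loc_iii \<Longrightarrow> chain_sym (Suc j) x = Loc_ii \<Longrightarrow>
         c * fib_len (Suc (Suc (Suc j))) \<le> fib_len (Suc j) + loc_len j x"
  shows "ereal (1 + c) \<le> rep x"
proof (rule rep_geI[OF finite_letters, of "fib_len (K + 3)"])
  fix n i p assume n: "fib_len (K + 3) \<le> n" and rep: "repeats x i p n"
  \<comment> \<open>Places p between consecutive Fibonacci lengths, F(j+1) <= p < F(j+2); the bound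
    on n then forces K <= j.\<close>
  define m where "m = (LEAST m. p < fib_len m)"
  have "p < fib_len (Suc p)" using fib_len_ge[of "Suc p"] by simp
  then have m: "p < fib_len m" unfolding m_def by (rule LeastI)
  have p: "0 < p" using rep by (simp add: repeats_def)
  have "m \<noteq> 0" "m \<noteq> Suc 0" using m p by (auto intro: ccontr)
  then obtain j where j: "m = Suc (Suc j)" by (metis not0_implies_Suc)
  have lo: "fib_len (Suc j) \<le> p" using not_less_Least[of "Suc j" "\<lambda>m. p < fib_len m"] j m_def by simp
  have "n + 1 < fib_len (Suc (Suc (Suc j)))" using repeats_length(1)[OF codes rep lo] m j by blast
  then have "\<not> Suc (Suc (Suc j)) \<le> K + 3" using n fib_len_mono[of "Suc (Suc (Suc j))" "K + 3"] by linarith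
  then have "K \<le> j" by simp
  then show "c * real n \<le> real (i + p)"
    using repeats_ratio_ge[OF rep lo _ c] m j K[of j] K(1)[of "Suc j"] K(1)[of "Suc (Suc j)"] by simp
qed

lemma rep_upper:
  fixes c :: real
  assumes "ereal (1 + c) < rep x"
  shows "\<exists>K. \<forall>j\<ge>K. (chain_sym j x = Loc_i \<longrightarrow> c * (loc_len j x + real (fib_len (Suc (Suc j))) - 2) \<le> fib_len (Suc j)) \<and>
    (chain_sym j x = Loc_iii \<and> chain_sym (Suc j) x = Loc_ii \<longrightarrow>
       c * (real (fib_len (Suc (Suc (Suc j)))) - 2) \<le> fib_len (Suc j) + loc_len j x)"
proof -
  obtain N where N: "\<And>n i p. n \<ge> N \<Longrightarrow> repeats x i p n \<Longrightarrow> c * real n < real (i + p)"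
    using rep_gtD[OF assms] by blast
  show ?thesis
  proof (intro exI allI impI conjI; (elim conjE)?)
    \<comment> \<open>The summand 2 makes up for the two letters lost in truncation, so that both
      repetitions have length at least N.\<close>
    fix j assume j: "N + 2 \<le> j"
    have F: "N + 2 \<le> fib_len (Suc (Suc j))" "N + 2 \<le> fib_len (Suc (Suc (Suc j)))"
      using j fib_len_ge[of "Suc (Suc j)"] fib_len_ge[of "Suc (Suc (Suc j))"] by linarith+
    show "c * (loc_len j x + real (fib_len (Suc (Suc j))) - 2) \<le> fib_len (Suc j)" if "chain_sym j x = Loc_i"
    proof -
      let ?n = "loc_len j x + fib_len (Suc (Suc j)) - 2"
      have "c * real ?n < real (0 + fib_len (Suc j))" using F(1) by (intro N repeats_i that) linarith
      moreover have "real ?n = loc_len j x + real (fib_len (Suc (Suc j))) - 2"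
        using F(1) by linarith
      ultimately show ?thesis by simp
    qed
    show "c * (real (fib_len (Suc (Suc (Suc j)))) - 2) \<le> fib_len (Suc j) + loc_len j x"
      if "chain_sym j x = Loc_iii" "chain_sym (Suc j) x = Loc_ii"
    proof -
      let ?n = "fib_len (Suc (Suc (Suc j))) - 2"
      have "c * real ?n < real (loc_len j x + fib_len (Suc j))"
        using F(2) by (intro N repeats_iii_ii that) linarith
      moreover have "real ?n = real (fib_len (Suc (Suc (Suc j)))) - 2" using F(2) by linarith
      ultimately show ?thesis by simp
    qed
  qed
qed

end

section \<open>Limits along the chain\<close>

lemma fib_len_ratio: "\<bar>real (fib_len (Suc j)) * phi - real (fib_len j)\<bar> \<le> 1"
  unfolding fib_len_phi abs_minus_cancel power_abs by (rule power_le_one) simp_all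

lemma ereal_1_plus_leI:
  assumes "0 < \<mu>" "\<And>c. 0 < c \<Longrightarrow> c < \<mu> \<Longrightarrow> ereal (1 + c) \<le> r"
  shows "ereal (1 + \<mu>) \<le> r"
proof (rule ccontr)
  assume "\<not> ereal (1 + \<mu>) \<le> r"
  then obtain z where z: "r < ereal z" "ereal z < ereal (1 + \<mu>)"
    using ereal_dense2[of r "ereal (1 + \<mu>)"] by (metis not_le)
  define c where "c = max (z - 1) (\<mu> / 2)"
  have "0 < c" "c < \<mu>" "z \<le> 1 + c" using assms(1) z(2) by (auto simp: c_def)
  then have "ereal z \<le> r" using assms(2)[of c] by (meson ereal_less_eq(3) order_trans)
  then show False using z(1) by simp
qed

context
  fixes \<alpha> :: real and x :: "nat stream"
  assumes codes: "codes \<alpha> x"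
begin

text \<open>A bounded error D does not affect the lower limit: for c below \<open>\<mu>\<close> it
  is absorbed once the Fibonacci lengths exceed D / (\<open>\<mu>\<close> - c).\<close>

lemma rep_ge_limit:
  fixes \<mu> D :: real
  assumes \<mu>: "0 < \<mu>" "\<mu> \<le> 1"
    and K: "\<And>j. K \<le> j \<Longrightarrow> \<mu> * fib_len (Suc j) \<le> fib_len j + D"
      "\<And>j. K \<le> j \<Longrightarrow> chain_sym j x = Loc_i \<Longrightarrow> \<mu> * (loc_len j x + fib_len (Suc (Suc j))) \<le> fib_len (Suc j) + D"
      "\<And>j. K \<le> j \<Longrightarrow> chain_sym j x = Loc_iii \<Longrightarrow> chain_sym (Suc j) x = Loc_ii \<Longrightarrow>
         \<mu> * fib_len (Suc (Suc (Suc j))) \<le> fib_len (Suc j) + loc_len j x + D"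
  shows "ereal (1 + \<mu>) \<le> rep x"
proof (rule ereal_1_plus_leI[OF \<mu>(1)])
  fix c assume c: "0 < c" "c < \<mu>"
  obtain M :: nat where M: "D / (\<mu> - c) \<le> real M" using real_arch_simple by blast
  have less: "c * a \<le> b" if "\<mu> * a \<le> b + D" "real M \<le> a" for a b
  proof -
    have "D \<le> (\<mu> - c) * real M" using M c(2) by (simp add: field_simps)
    also have "\<dots> \<le> (\<mu> - c) * a" using that(2) c(2) by (intro mult_left_mono) auto
    finally show ?thesis using that(1) by (simp add: algebra_simps)
  qed
  have M_le: "real M \<le> real (fib_len k) + real w" if "M \<le> k" for k w :: nat
    using fib_len_ge[of k] that by linarith
  show "ereal (1 + c) \<le> rep x"
  proof (rule rep_lower[OF codes c(1), of "K + M"])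
    show "c \<le> 1" using c \<mu> by simp
  next
    fix j assume j: "K + M \<le> j"
    show "c * fib_len (Suc j) \<le> fib_len j"
      using K(1)[of j] M_le[of "Suc j" 0] j by (intro less) (auto simp del: fib_len_simps)
    show "c * (loc_len j x + fib_len (Suc (Suc j))) \<le> fib_len (Suc j)" if "chain_sym j x = Loc_i"
      using K(2)[of j] M_le[of "Suc (Suc j)" "loc_len j x"] j that
      by (intro less) (auto simp del: fib_len_simps simp: add.commute)
    show "c * fib_len (Suc (Suc (Suc j))) \<le> fib_len (Suc j) + loc_len j x"
      if "chain_sym j x = Loc_iii" "chain_sym (Suc j) x = Loc_ii"
      using K(3)[of j] M_le[of "Suc (Suc (Suc j))" 0] j that
      by (intro less) (auto simp del: fib_len_simps simp: add.commute)
  qed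
qed

text \<open>Only symbols (i) are considered, since in each use below the smallest ratio occurs
  there.\<close>

lemma rep_le_limit:
  fixes \<mu> D :: real
  assumes \<mu>: "0 < \<mu>"
    and inf: "\<And>N. \<exists>j\<ge>N. chain_sym j x = Loc_i \<and> fib_len (Suc j) \<le> \<mu> * (loc_len j x + fib_len (Suc (Suc j))) + D"
  shows "rep x \<le> ereal (1 + \<mu>)"
proof (rule ccontr)
  assume "\<not> rep x \<le> ereal (1 + \<mu>)"
  then obtain z where z: "ereal (1 + \<mu>) < ereal z" "ereal z < rep x"
    using ereal_dense2[of "ereal (1 + \<mu>)" "rep x"] by (metis not_le)
  define c where "c = z - 1"
  have c: "\<mu> < c" "ereal (1 + c) < rep x" using z by (auto simp: c_def)
  from rep_upper[OF codes c(2)] obtain K where K: "\<And>j. j \<ge> K \<Longrightarrow> chain_sym j x = Loc_i \<Longrightarrow>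
    c * (loc_len j x + real (fib_len (Suc (Suc j))) - 2) \<le> fib_len (Suc j)" by blast
  obtain M :: nat where M: "(D + 2 * c) / (c - \<mu>) \<le> real M" using real_arch_simple by blast
  obtain j where j: "j \<ge> K + M" "chain_sym j x = Loc_i"
    "fib_len (Suc j) \<le> \<mu> * (loc_len j x + fib_len (Suc (Suc j))) + D" using inf[of "K + M"] by blast
  let ?a = "loc_len j x + real (fib_len (Suc (Suc j)))"
  have "c * ?a - 2 * c \<le> \<mu> * ?a + D" using K[of j] j by (simp add: algebra_simps del: fib_len_simps)
  then have "(c - \<mu>) * ?a \<le> D + 2 * c" by (simp add: algebra_simps del: fib_len_simps)
  moreover have "real M < ?a" using fib_len_ge[of "Suc (Suc j)"] j(1) by linarith
  then have "(c - \<mu>) * real M < (c - \<mu>) * ?a" using c by (intro mult_strict_left_mono) auto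
  ultimately have "(c - \<mu>) * real M < D + 2 * c" by linarith
  then show False using M c by (simp add: field_simps)
qed

end

section \<open>Eventually periodic sequences of symbols\<close>

definition ev_periodic :: "'a list \<Rightarrow> (nat \<Rightarrow> 'a) \<Rightarrow> bool" where
  "ev_periodic p s \<longleftrightarrow> (\<exists>K. \<forall>n. s (K + n) = p ! (n mod length p))"

lemma ev_periodicI:
  assumes "p \<noteq> []" "\<And>d r. r < length p \<Longrightarrow> s (K + length p * d + r) = p ! r"
  shows "ev_periodic p s"
  unfolding ev_periodic_def
proof (intro exI allI)
  fix n
  have "s (K + length p * (n div length p) + n mod length p) = p ! (n mod length p)"
    by (rule assms(2)) (use assms(1) in simp)
  then show "s (K + n) = p ! (n mod length p)" unfolding add.assoc mult_div_mod_eq .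
qed

lemma ev_periodicD:
  assumes "ev_periodic p s" "p \<noteq> []"
  shows "\<exists>K. \<forall>d r. r < length p \<longrightarrow> s (K + length p * d + r) = p ! r"
proof -
  obtain K where K: "\<And>n. s (K + n) = p ! (n mod length p)" using assms(1) unfolding ev_periodic_def by blast
  have "s (K + length p * d + r) = p ! r" if "r < length p" for d r
    using K[of "length p * d + r"] that by (simp add: add.assoc)
  then show ?thesis by blast
qed

lemma cycle_snth: "p \<noteq> [] \<Longrightarrow> cycle p !! n = p ! (n mod length p)"
proof -
  assume p: "p \<noteq> []"
  have "cycle p !! n = shd (sdrop n (cycle p))" by simp
  also have "\<dots> = hd (rotate (n mod length p) p)" using p unfolding sdrop_cycle[OF p] by simp
  also have "\<dots> = p ! (n mod length p)" using p by (simp add: hd_rotate_conv_nth)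
  finally show ?thesis .
qed

lemma ev_periodic_cycle:
  assumes "p \<noteq> []"
  shows "(\<exists>u. c = u @- cycle p) \<longleftrightarrow> ev_periodic p (snth c)"
proof
  assume "\<exists>u. c = u @- cycle p"
  then obtain u where u: "c = u @- cycle p" by blast
  have "c !! (length u + n) = p ! (n mod length p)" for n
    by (subst u) (simp add: cycle_snth[OF assms])
  then show "ev_periodic p (snth c)" unfolding ev_periodic_def by blast
next
  assume "ev_periodic p (snth c)"
  then obtain K where K: "\<And>n. c !! (K + n) = p ! (n mod length p)" unfolding ev_periodic_def by blast
  have "sdrop K c !! n = cycle p !! n" for n using K by (simp add: sdrop_snth cycle_snth[OF assms])
  then have "sdrop K c = cycle p" by (metis stream_smap_nats stream.map_cong)
  then show "\<exists>u. c = u @- cycle p" by (metis stake_sdrop)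
qed

abbreviation (input) "pat_a \<equiv> [Loc_i, Loc_iii]"
abbreviation (input) "pat_b \<equiv> [Loc_ii]"
abbreviation (input) "pat_ab \<equiv> [Loc_i, Loc_iii, Loc_ii]"
abbreviation (input) "pat_bbaa \<equiv> [Loc_ii, Loc_ii, Loc_i, Loc_iii, Loc_i, Loc_iii]"

section \<open>Chains with a large exponent of repetition\<close>

text \<open>The bounds below hold with some \<open>K\<close> for every word with \<open>rep x > 1 + 11 / 25\<close>; the number \<open>11 / 25\<close>
  is slightly below \<open>mu3 - 1\<close>.\<close>

locale large_chain =
  fixes s :: "nat \<Rightarrow> loc_symbol" and w :: "nat \<Rightarrow> nat" and K :: nat
  assumes iii_iff: "\<And>j. s (Suc j) = Loc_iii \<longleftrightarrow> s j = Loc_i"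
    and w_Suc: "\<And>j. w (Suc j) = w j + (if s j = Loc_ii then fib_len j else 0)"
    and w_le: "\<And>j. w j \<le> fib_len (Suc j)"
    and bound_i: "\<And>j. K \<le> j \<Longrightarrow> s j = Loc_i \<Longrightarrow>
      11 / 25 * (w j + real (fib_len (Suc (Suc j))) - 2) \<le> fib_len (Suc j)"
    and bound_iii: "\<And>j. K \<le> j \<Longrightarrow> s j = Loc_iii \<Longrightarrow> s (Suc j) = Loc_ii \<Longrightarrow>
      11 / 25 * (real (fib_len (Suc (Suc (Suc j)))) - 2) \<le> fib_len (Suc j) + w j"
    and K_large: "100000 \<le> K"
begin

text \<open>From index K on, the error of at most 1 in F(j) = phi F(j+1) fits between the rational
  bounds, so each forbidden pattern below is settled by linear arithmetic.\<close>

lemma ratio: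
  assumes "K \<le> j"
  shows "6180 / 10000 * real (fib_len (Suc j)) \<le> fib_len j"
    and "fib_len j \<le> 6181 / 10000 * real (fib_len (Suc j))"
    and "100000 \<le> real (fib_len j)"
proof -
  have F: "100000 \<le> real (fib_len j)" "100000 \<le> real (fib_len (Suc j))"
    using assms K_large fib_len_ge[of j] fib_len_ge[of "Suc j"] by linarith+
  have "618033 / 1000000 * real (fib_len (Suc j)) \<le> phi * real (fib_len (Suc j))"
    "phi * real (fib_len (Suc j)) \<le> 618034 / 1000000 * real (fib_len (Suc j))"
    using phi_bounds by (intro mult_right_mono; simp)+
  then show "6180 / 10000 * real (fib_len (Suc j)) \<le> fib_len j"
    "fib_len j \<le> 6181 / 10000 * real (fib_len (Suc j))" "100000 \<le> real (fib_len j)"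
    using F fib_len_ratio[of j] unfolding mult.commute[of _ phi] by linarith+
qed

lemma bound_i':
  assumes "K \<le> j" "s j = Loc_i" "j1 = j + 1" "j2 = j + 2"
  shows "11 / 25 * (real (w j) + real (fib_len j2) - 2) \<le> real (fib_len j1)"
  using bound_i[OF assms(1,2)] assms(3,4) by (simp del: fib_len_simps)

lemma bound_iii':
  assumes "K \<le> j" "s j1 = Loc_ii" "s j = Loc_iii" "j1 = j + 1" "j3 = j + 3"
  shows "11 / 25 * (real (fib_len j3) - 2) \<le> real (fib_len j1) + real (w j)"
proof -
  have "s (Suc j) = Loc_ii" "Suc (Suc (Suc j)) = j3" "Suc j = j1" using assms by simp_all
  then show ?thesis using bound_iii[OF assms(1,3)] by (metis of_nat_add)
qed

lemma fib_len_add: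
  "real (fib_len (m + 2)) = fib_len m + fib_len (m + 1)"
  "real (fib_len (m + 3)) = fib_len m + 2 * real (fib_len (m + 1))"
  "real (fib_len (m + 4)) = 2 * real (fib_len m) + 3 * real (fib_len (m + 1))"
  "real (fib_len (m + 5)) = 3 * real (fib_len m) + 5 * real (fib_len (m + 1))"
  "real (fib_len (m + 6)) = 5 * real (fib_len m) + 8 * real (fib_len (m + 1))"
  "real (fib_len (m + 7)) = 8 * real (fib_len m) + 13 * real (fib_len (m + 1))"
  "real (fib_len (m + 8)) = 13 * real (fib_len m) + 21 * real (fib_len (m + 1))"
  "real (fib_len (m + 9)) = 21 * real (fib_len m) + 34 * real (fib_len (m + 1))"
  by (simp_all add: eval_nat_numeral)

lemma length_pats:
  "length pat_a = 2" "length pat_ab = 3" "length pat_bbaa = 6"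
  by simp_all

text \<open>Three symbols (ii) raise w to at least 2 F(m+2), so F(m+4) / (w + F(m+5)) is about 0.420
  or less.\<close>

lemma no_bbba:
  assumes "K \<le> m" "s m = Loc_ii" "s (m + 1) = Loc_ii" "s (m + 2) = Loc_ii"
  shows "s (m + 3) \<noteq> Loc_i"
proof
  assume "s (m + 3) = Loc_i"
  moreover have "w (m + 3) = w m + fib_len m + fib_len (m + 1) + fib_len (m + 2)"
    using assms w_Suc[of m] w_Suc[of "m + 1"] w_Suc[of "m + 2"] by (simp add: eval_nat_numeral)
  moreover have "11 / 25 * (real (w (m + 3)) + real (fib_len (m + 5)) - 2) \<le> real (fib_len (m + 4))"
    by (rule bound_i') (use \<open>s (m + 3) = Loc_i\<close> assms(1) in simp_all)
  ultimately show False
    using ratio[OF assms(1)] fib_len_add[of m] by simp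
qed

text \<open>Along aaa, w stays at most F(m+1), so (F(m+6) + w) / F(m+8) is about 0.416 or
  less.\<close>

lemma no_aaab:
  assumes "K \<le> m" "s m = Loc_i" "s (m + 2) = Loc_i" "s (m + 4) = Loc_i"
  shows "s (m + 6) \<noteq> Loc_ii"
proof
  assume "s (m + 6) = Loc_ii"
  moreover have iii: "s (m + 1) = Loc_iii" "s (m + 3) = Loc_iii" "s (m + 5) = Loc_iii"
    using assms iii_iff[of m] iii_iff[of "m + 2"] iii_iff[of "m + 4"] by (simp_all add: eval_nat_numeral)
  moreover have "w (m + 5) = w m"
    using assms iii w_Suc[of m] w_Suc[of "m + 1"] w_Suc[of "m + 2"] w_Suc[of "m + 3"] w_Suc[of "m + 4"]
    by (simp add: eval_nat_numeral)
  moreover have "11 / 25 * (real (fib_len (m + 8)) - 2) \<le> real (fib_len (m + 6)) + real (w (m + 5))"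
    by (rule bound_iii') (use \<open>s (m + 6) = Loc_ii\<close> iii assms(1) in simp_all)
  moreover have "w m \<le> fib_len (m + 1)" using w_le[of m] by simp
  ultimately show False
    using ratio[OF assms(1)] fib_len_add[of m] by simp
qed

text \<open>The first (i) keeps \<open>w m\<close> below about 0.655 F(m+1), and the one (ii) adds
  F(m+2); then (F(m+7) + w) / F(m+9) is about 0.430 or less.\<close>

lemma no_abaab:
  assumes "K \<le> m" "s m = Loc_i" "s (m + 2) = Loc_ii" "s (m + 3) = Loc_i" "s (m + 5) = Loc_i"
  shows "s (m + 7) \<noteq> Loc_ii"
proof
  assume "s (m + 7) = Loc_ii"
  moreover have iii: "s (m + 1) = Loc_iii" "s (m + 4) = Loc_iii" "s (m + 6) = Loc_iii"
    using assms iii_iff[of m] iii_iff[of "m + 3"] iii_iff[of "m + 5"] by (simp_all add: eval_nat_numeral)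
  moreover have "w (m + 6) = w m + fib_len (m + 2)"
    using assms iii w_Suc[of m] w_Suc[of "m + 1"] w_Suc[of "m + 2"] w_Suc[of "m + 3"] w_Suc[of "m + 4"]
      w_Suc[of "m + 5"] by (simp add: eval_nat_numeral)
  moreover have "11 / 25 * (real (fib_len (m + 9)) - 2) \<le> real (fib_len (m + 7)) + real (w (m + 6))"
    by (rule bound_iii') (use \<open>s (m + 7) = Loc_ii\<close> iii assms(1) in simp_all)
  moreover have "11 / 25 * (real (w m) + real (fib_len (m + 2)) - 2) \<le> real (fib_len (m + 1))"
    by (rule bound_i') (use assms in simp_all)
  ultimately show False
    using ratio[OF assms(1)] fib_len_add[of m] by simp
qed

text \<open>The symbols (ii) add F(m) + F(m+3) + F(m+4) to w, so F(m+6) / (w + F(m+7)) is about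
  0.436 or less, just below 11 / 25.\<close>

lemma no_babba:
  assumes "K \<le> m" "s m = Loc_ii" "s (m + 1) = Loc_i" "s (m + 3) = Loc_ii" "s (m + 4) = Loc_ii"
  shows "s (m + 5) \<noteq> Loc_i"
proof
  assume "s (m + 5) = Loc_i"
  moreover have iii: "s (m + 2) = Loc_iii" using assms iii_iff[of "m + 1"] by (simp add: eval_nat_numeral)
  moreover have "w (m + 5) = w m + fib_len m + fib_len (m + 3) + fib_len (m + 4)"
    using assms iii w_Suc[of m] w_Suc[of "m + 1"] w_Suc[of "m + 2"] w_Suc[of "m + 3"] w_Suc[of "m + 4"]
    by (simp add: eval_nat_numeral)
  moreover have "11 / 25 * (real (w (m + 5)) + real (fib_len (m + 7)) - 2) \<le> real (fib_len (m + 6))"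
    by (rule bound_i') (use \<open>s (m + 5) = Loc_i\<close> assms(1) in simp_all)
  ultimately show False
    using ratio[OF assms(1)] fib_len_add[of m] by simp
qed

text \<open>A run of three (ii) never ends: (i) is excluded by \<open>no_bbba\<close>, and (iii)
  only follows (i). In the same way \<open>no_aaab\<close> gives \<open>aaa_ev_a\<close>.\<close>

lemma bbb_ev_b:
  assumes "K \<le> m" "s m = Loc_ii" "s (m + 1) = Loc_ii" "s (m + 2) = Loc_ii"
  shows "ev_periodic pat_b s"
proof -
  have "s (m + d) = Loc_ii \<and> s (m + d + 1) = Loc_ii \<and> s (m + d + 2) = Loc_ii" for d
  proof (induction d)
    case (Suc d)
    then have "s (m + d + 3) \<noteq> Loc_i" using no_bbba[of "m + d"] assms(1) by simp
    moreover have "s (m + d + 3) \<noteq> Loc_iii" using Suc iii_iff[of "m + d + 2"] by (simp add: eval_nat_numeral)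
    ultimately show ?case using Suc by (cases "s (m + d + 3)") (auto simp: eval_nat_numeral)
  qed (use assms in simp)
  then show ?thesis by (intro ev_periodicI[of _ s m]) auto
qed

lemma aaa_ev_a:
  assumes "K \<le> m" "s m = Loc_i" "s (m + 2) = Loc_i" "s (m + 4) = Loc_i"
  shows "ev_periodic pat_a s"
proof -
  have *: "s (m + 2 * d) = Loc_i \<and> s (m + 2 * d + 2) = Loc_i \<and> s (m + 2 * d + 4) = Loc_i" for d
  proof (induction d)
    case (Suc d)
    then have "s (m + 2 * d + 6) \<noteq> Loc_ii" using no_aaab[of "m + 2 * d"] assms(1) by simp
    moreover have "s (m + 2 * d + 6) \<noteq> Loc_iii"
      using Suc iii_iff[of "m + 2 * d + 4"] iii_iff[of "m + 2 * d + 5"] by (simp add: eval_nat_numeral)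
    ultimately show ?case using Suc by (cases "s (m + 2 * d + 6)") (auto simp: eval_nat_numeral)
  qed (use assms in simp)
  have "s (m + 2 * d + r) = pat_a ! r" if "r < 2" for d r
    using *[of d] iii_iff[of "m + 2 * d"] that by (auto simp: less_2_cases_iff)
  then show ?thesis by (intro ev_periodicI[of pat_a s m, unfolded length_pats]) simp_all
qed

text \<open>The patterns are resolved backwards: before bba comes a (no bbb), before that a (no
  babba), then b (no aaa), then b (no abaab).\<close>

lemma bba_preceded:
  assumes k: "K \<le> k" and bba: "s (k + 7) = Loc_ii" "s (k + 8) = Loc_ii" "s (k + 9) = Loc_i"
    and no: "\<not> ev_periodic pat_a s" "\<not> ev_periodic pat_b s"
  shows "s (k + 1) = Loc_ii \<and> s (k + 2) = Loc_ii \<and> s (k + 3) = Loc_i \<and> s (k + 4) = Loc_iii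
     \<and> s (k + 5) = Loc_i \<and> s (k + 6) = Loc_iii"
proof -
  have t: "s (k + Suc d) = Loc_iii \<longleftrightarrow> s (k + d) = Loc_i" for d using iii_iff[of "k + d"] by simp
  have 6: "s (k + 6) = Loc_iii"
    using t[of 6] bba bbb_ev_b[of "k + 6"] k no by (cases "s (k + 6)") (auto simp: eval_nat_numeral)
  have 5: "s (k + 5) = Loc_i" using t[of 5] 6 by (simp add: eval_nat_numeral)
  have 4: "s (k + 4) = Loc_iii"
    using t[of 4] 5 no_babba[of "k + 4"] k bba by (cases "s (k + 4)") (auto simp: eval_nat_numeral)
  have 3: "s (k + 3) = Loc_i" using t[of 3] 4 by (simp add: eval_nat_numeral)
  have 2: "s (k + 2) = Loc_ii"
    using t[of 2] t[of 1] 3 5 aaa_ev_a[of "k + 1"] k no by (cases "s (k + 2)") (auto simp: eval_nat_numeral)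
  have 1: "s (k + 1) = Loc_ii"
    using t[of 1] t[of 0] 2 3 5 bba no_abaab[of k] k by (cases "s (k + 1)") (auto simp: eval_nat_numeral)
  show ?thesis using 1 2 3 4 5 6 by blast
qed

text \<open>As \<open>bba_preceded\<close> only looks back, the period is anchored at some k0 whose
  residue class modulo 6 contains infinitely many bba. Going back from each of them in steps of 6
  fills in everything down to k0.\<close>

lemma infinite_bba:
  assumes inf: "infinite {k. s k = Loc_ii \<and> s (k + 1) = Loc_ii \<and> s (k + 2) = Loc_i}"
    and no: "\<not> ev_periodic pat_a s" "\<not> ev_periodic pat_b s"
  shows "ev_periodic pat_bbaa s"
proof -
  let ?B = "\<lambda>k. s k = Loc_ii \<and> s (k + 1) = Loc_ii \<and> s (k + 2) = Loc_i"
  let ?A = "{k. ?B k} - {..K}"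
  have "infinite ?A" using inf by simp
  moreover have "finite ((\<lambda>k. k mod 6) ` ?A)"
    by (rule finite_subset[of _ "{..<6}"]) auto
  ultimately obtain k0 where k0: "k0 \<in> ?A" "infinite {k \<in> ?A. k mod 6 = k0 mod 6}"
    using pigeonhole_infinite by blast
  have descend: "?B k \<Longrightarrow> K < k - 6 * d \<Longrightarrow> 6 * d \<le> k \<Longrightarrow> ?B (k - 6 * d) \<and>
    (\<forall>e r. e < d \<longrightarrow> r < 6 \<longrightarrow> s (k - 6 * d + 6 * e + r) = pat_bbaa ! r)" for k d
  proof (induction d)
    case (Suc d)
    obtain q where k: "k - 6 * d = q + 7" "k - 6 * Suc d = q + 1" "K \<le> q"
      using Suc.prems that[of "k - 6 * Suc d - 1"] by auto
    have IH: "?B (q + 7)" "\<And>e r. e < d \<Longrightarrow> r < 6 \<Longrightarrow> s (q + 7 + 6 * e + r) = pat_bbaa ! r"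
      using Suc.IH Suc.prems unfolding k(1)[symmetric] by auto
    have 1: "s (q + 1) = Loc_ii \<and> s (q + 2) = Loc_ii \<and> s (q + 3) = Loc_i \<and> s (q + 4) = Loc_iii
     \<and> s (q + 5) = Loc_i \<and> s (q + 6) = Loc_iii"
      using IH(1) by (intro bba_preceded k(3) no) (simp_all add: add.commute)
    have "s (q + 1 + 6 * e + r) = pat_bbaa ! r" if "e < Suc d" "r < 6" for e r
    proof (cases e)
      case 0
      have "r = 0 \<or> r = 1 \<or> r = 2 \<or> r = 3 \<or> r = 4 \<or> r = 5" using that(2) by linarith
      then show ?thesis using 1 0 by (auto simp: eval_nat_numeral)
    next
      case (Suc e')
      then show ?thesis using IH(2)[of e' r] that by (simp add: ac_simps)
    qed
    moreover have "?B (q + 1)" using 1 by (simp add: eval_nat_numeral)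
    ultimately show ?case unfolding k(2) by blast
  qed simp
  have "s (k0 + 6 * e + r) = pat_bbaa ! r" if "r < 6" for e r
  proof -
    have "\<not> {k \<in> ?A. k mod 6 = k0 mod 6} \<subseteq> {..k0 + 6 * e}"
      using k0(2) finite_subset by blast
    then obtain k where "k \<in> ?A" "k mod 6 = k0 mod 6" "k \<notin> {..k0 + 6 * e}" by blast
    then have k: "?B k" "k mod 6 = k0 mod 6" "k0 + 6 * e < k" by auto
    have "k0 \<le> k" using k(3) by linarith
    then have "6 dvd k - k0" using k(2) mod_eq_dvd_iff_nat by metis
    then obtain d where "k - k0 = 6 * d" by (rule dvdE)
    then have d: "k = k0 + 6 * d" using \<open>k0 \<le> k\<close> by linarith
    have "k - 6 * d = k0" "e < d" "6 * d \<le> k" "K < k0" using d k(3) k0(1) by auto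
    then show ?thesis using descend[OF k(1), of d] that by simp
  qed
  then show ?thesis by (intro ev_periodicI[of pat_bbaa s k0, unfolded length_pats]) simp_all
qed

text \<open>Without late bba, a late bb would grow to bbb. A late aa has b on both sides (no aaa);
  before its first b comes b, giving a late bba, or a, giving abaab. So a and b alternate.\<close>

lemma finite_bba:
  assumes fin: "finite {k. s k = Loc_ii \<and> s (k + 1) = Loc_ii \<and> s (k + 2) = Loc_i}"
    and no: "\<not> ev_periodic pat_a s" "\<not> ev_periodic pat_b s"
  shows "ev_periodic pat_ab s"
proof -
  let ?B = "\<lambda>k. s k = Loc_ii \<and> s (k + 1) = Loc_ii \<and> s (k + 2) = Loc_i"
  obtain N where N: "\<And>k. ?B k \<Longrightarrow> k \<le> N" using fin finite_nat_set_iff_bounded_le by auto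
  have step: "s (n + 4) = Loc_iii \<and> s (n + 5) = Loc_ii \<and> s (n + 6) = Loc_i"
    if n: "N + K < n" "s (n + 3) = Loc_i" for n
  proof -
    have t: "s (n + Suc d) = Loc_iii \<longleftrightarrow> s (n + d) = Loc_i" for d using iii_iff[of "n + d"] by simp
    have 4: "s (n + 4) = Loc_iii" using t[of 3] n(2) by (simp add: eval_nat_numeral)
    have 5: "s (n + 5) = Loc_ii"
    proof (cases "s (n + 5)")
      case Loc_i
      have 2: "s (n + 2) = Loc_ii"
        using t[of 2] t[of 1] n aaa_ev_a[of "n + 1"] Loc_i no by (cases "s (n + 2)") (auto simp: eval_nat_numeral)
      have 7: "s (n + 7) = Loc_ii"
        using t[of 6] t[of 5] n aaa_ev_a[of "n + 3"] Loc_i no by (cases "s (n + 7)") (auto simp: eval_nat_numeral)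
      have "s (n + 1) = Loc_ii"
        using t[of 1] t[of 0] 2 n Loc_i 7 no_abaab[of n] by (cases "s (n + 1)") (auto simp: eval_nat_numeral)
      then show ?thesis using N[of "n + 1"] 2 n by (simp add: eval_nat_numeral)
    qed (use t[of 4] 4 in \<open>auto simp: eval_nat_numeral\<close>)
    have "s (n + 6) = Loc_i"
    proof (cases "s (n + 6)")
      case Loc_ii
      then show ?thesis
        using t[of 6] 5 bbb_ev_b[of "n + 5"] N[of "n + 5"] n no by (cases "s (n + 7)") (auto simp: eval_nat_numeral)
    qed (use t[of 5] 5 in \<open>auto simp: eval_nat_numeral\<close>)
    then show ?thesis using 4 5 by blast
  qed
  have "\<exists>n. N + K < n \<and> s (n + 3) = Loc_i"
  proof (rule ccontr)
    assume "\<not> ?thesis"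
    then have ni: "s (n + 3) \<noteq> Loc_i" if "N + K < n" for n using that by blast
    have "s (N + K + 5 + d) = Loc_ii" for d
      using ni[of "N + K + 2 + d"] ni[of "N + K + 1 + d"] iii_iff[of "N + K + 4 + d"]
      by (cases "s (N + K + 5 + d)") (auto simp: eval_nat_numeral)
    then show False using no(2) ev_periodicI[of pat_b s "N + K + 5"] by auto
  qed
  then obtain n where n: "N + K < n" "s (n + 3) = Loc_i" by blast
  have all: "s (n + 3 + 3 * d) = Loc_i" for d
    by (induction d) (use n step[of "n + 3 * d" for d] in \<open>auto simp: eval_nat_numeral\<close>)
  have "s (n + 3 + 3 * d + r) = pat_ab ! r" if "r < 3" for d r
  proof -
    have "r = 0 \<or> r = 1 \<or> r = 2" using that by linarith
    then show ?thesis using all[of d] step[of "n + 3 * d"] n by (auto simp: eval_nat_numeral add.commute add.left_commute)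
  qed
  then show ?thesis by (intro ev_periodicI[of pat_ab s "n + 3", unfolded length_pats]) simp_all
qed

theorem classification:
  "ev_periodic pat_a s \<or> ev_periodic pat_b s \<or> ev_periodic pat_ab s \<or> ev_periodic pat_bbaa s"
  using infinite_bba finite_bba by blast

end

lemma rep_large_cases:
  assumes codes: "codes \<alpha> x" and large: "ereal (1 + 11 / 25) < rep x"
  shows "ev_periodic pat_a (\<lambda>j. chain_sym j x) \<or> ev_periodic pat_b (\<lambda>j. chain_sym j x) \<or>
    ev_periodic pat_ab (\<lambda>j. chain_sym j x) \<or> ev_periodic pat_bbaa (\<lambda>j. chain_sym j x)"
proof -
  obtain K where K: "\<forall>j\<ge>K. (chain_sym j x = Loc_i \<longrightarrow> 11 / 25 * (loc_len j x + real (fib_len (Suc (Suc j))) - 2) \<le> fib_len (Suc j)) \<and>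
    (chain_sym j x = Loc_iii \<and> chain_sym (Suc j) x = Loc_ii \<longrightarrow>
       11 / 25 * (real (fib_len (Suc (Suc (Suc j)))) - 2) \<le> fib_len (Suc j) + loc_len j x)"
    using rep_upper[OF codes large] by blast
  interpret large_chain "\<lambda>j. chain_sym j x" "\<lambda>j. loc_len j x" "K + 100000"
    using K sym_i_iii[OF codes] sym_not_i loc_len_Suc[OF codes] loc_len_le[OF codes]
    by unfold_locales (auto simp del: fib_len_simps)
  show ?thesis by (rule classification)
qed

section \<open>Values of the exponent of repetition\<close>

lemma phi_sq_mult: "phi * (phi * z) = (1 - phi) * z"
  using phi_sq by (simp add: mult.assoc[symmetric])

lemma mu2_eq: "mu2 = 1 + (4 * phi - 2)"
  unfolding mu2_def phi_cube by simp

text \<open>By phi^2 = 1 - phi all powers become linear in phi. The fraction is the form in which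
  \<open>rep_bbaa\<close> produces the limit.\<close>

lemma mu3_eq: "mu3 = 1 + 4 / (5 * phi + 6)"
proof -
  have 2: "phi ^ 2 = 1 - phi" by (simp add: power2_eq_square phi_sq)
  have 4: "phi ^ 4 = 2 - 3 * phi"
  proof -
    have "phi ^ 4 = phi ^ 2 * phi ^ 2" by (simp flip: power_add)
    also have "\<dots> = 1 - 2 * phi + phi * phi" unfolding 2 by (simp add: algebra_simps)
    finally show ?thesis unfolding phi_sq by simp
  qed
  have 5: "phi ^ 5 = 5 * phi - 3"
  proof -
    have "phi ^ 5 = phi * phi ^ 4" by (simp flip: power_Suc)
    also have "\<dots> = 2 * phi - 3 * (phi * phi)" unfolding 4 by (simp add: algebra_simps)
    finally show ?thesis unfolding phi_sq by simp
  qed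
  have "(phi ^ 2 * (phi ^ 4 + phi ^ 2 + 1)) * (5 * phi + 6) = 4 * (phi ^ 5 + phi ^ 3 + 1)"
    unfolding 2 4 5 phi_cube by (simp add: algebra_simps phi_sq phi_sq_mult)
  moreover have "0 < 5 * phi + 6" "0 < phi ^ 5 + phi ^ 3 + 1"
    using phi_pos by (simp_all add: add_pos_pos)
  then have "5 * phi + 6 \<noteq> 0" "phi ^ 5 + phi ^ 3 + 1 \<noteq> 0" by linarith+
  ultimately have "phi ^ 2 * (phi ^ 4 + phi ^ 2 + 1) / (phi ^ 5 + phi ^ 3 + 1) = 4 / (5 * phi + 6)"
    by (simp add: frac_eq_eq)
  then show ?thesis unfolding mu3_def by simp
qed

lemma mu3_bounds: "440035 / 1000000 < 4 / (5 * phi + 6)" "4 / (5 * phi + 6) < 440037 / 1000000"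
proof -
  have pos: "0 < 5 * phi + 6" using phi_pos by linarith
  show "440035 / 1000000 < 4 / (5 * phi + 6)" "4 / (5 * phi + 6) < 440037 / 1000000"
    using pos phi_bounds by (simp_all add: field_simps)
qed

context
  fixes \<alpha> :: real and x :: "nat stream"
  assumes codes: "codes \<alpha> x"
begin

lemma phi_fib_len: "\<bar>phi * real (fib_len (Suc j)) - real (fib_len j)\<bar> \<le> 1"
  using fib_len_ratio[of j] by (simp add: mult.commute)

text \<open>Without (i) and (iii) only the ratio F(j) / F(j+1) matters. A lower bound is enough
  here: such values lie outside both gaps and differ from \<open>mu2\<close> and
  \<open>mu3\<close>.\<close>

lemma rep_ge_b:
  assumes "ev_periodic pat_b (\<lambda>j. chain_sym j x)"
  shows "ereal mu_max \<le> rep x"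
proof -
  obtain K where K: "\<And>n. chain_sym (K + n) x = Loc_ii" using assms unfolding ev_periodic_def by auto
  have s: "chain_sym j x = Loc_ii" if "K \<le> j" for j using K[of "j - K"] that by simp
  show ?thesis unfolding mu_max_def
  proof (rule rep_ge_limit[OF codes, of phi K 1])
    fix j assume "K \<le> j"
    show "phi * fib_len (Suc j) \<le> real (fib_len j) + 1" using phi_fib_len[of j] by linarith
  qed (use s in auto)
qed

text \<open>Without (ii) the length w is constant, so F(j+1) / (w + F(j+2)) tends to phi.\<close>

lemma rep_a:
  assumes "ev_periodic pat_a (\<lambda>j. chain_sym j x)"
  shows "rep x = ereal mu_max"
proof -
  have len: "length pat_a = 2" by simp
  obtain K where K: "\<And>n. chain_sym (K + n) x = pat_a ! (n mod 2)"
    using assms unfolding ev_periodic_def len by blast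
  have s: "chain_sym j x \<noteq> Loc_ii" if "K \<le> j" for j
  proof -
    have "chain_sym j x = pat_a ! ((j - K) mod 2)" using K[of "j - K"] that by simp
    moreover have "(j - K) mod 2 = 0 \<or> (j - K) mod 2 = 1" by linarith
    ultimately show ?thesis by auto
  qed
  have w: "loc_len (K + n) x = loc_len K x" for n
    by (induction n) (use loc_len_Suc[OF codes] s in auto)
  have w': "loc_len j x = loc_len K x" if "K \<le> j" for j using w[of "j - K"] that by simp
  have e: "phi * (loc_len j x + fib_len (Suc (Suc j))) - fib_len (Suc j) = phi * loc_len K x + (phi * fib_len (Suc (Suc j)) - fib_len (Suc j))"
    if "K \<le> j" for j unfolding w'[OF that] by (simp add: algebra_simps)
  have "ereal (1 + phi) \<le> rep x"
  proof (rule rep_ge_limit[OF codes, of phi K "phi * loc_len K x + 1"])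
    fix j assume j: "K \<le> j"
    have "0 \<le> phi * loc_len K x" by simp
    then show "phi * fib_len (Suc j) \<le> fib_len j + (phi * loc_len K x + 1)" using phi_fib_len[of j] by linarith
    show "phi * (loc_len j x + fib_len (Suc (Suc j))) \<le> fib_len (Suc j) + (phi * loc_len K x + 1)"
      using phi_fib_len[of "Suc j"] e[OF j] by linarith
  qed (use s in auto)
  moreover have "rep x \<le> ereal (1 + phi)"
  proof (rule rep_le_limit[OF codes, of phi 1])
    fix N
    have "chain_sym (K + 2 * N) x = Loc_i" using K[of "2 * N"] by simp
    moreover have "fib_len (Suc (K + 2 * N)) \<le> phi * (loc_len (K + 2 * N) x + fib_len (Suc (Suc (K + 2 * N)))) + 1"
    proof -
      have "0 \<le> phi * loc_len K x" by simp
      then show ?thesis using phi_fib_len[of "Suc (K + 2 * N)"] e[of "K + 2 * N"] by linarith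
    qed
    ultimately show "\<exists>j\<ge>N. chain_sym j x = Loc_i \<and> fib_len (Suc j) \<le> phi * (loc_len j x + fib_len (Suc (Suc j))) + 1"
      by (intro exI[of _ "K + 2 * N"]) auto
  qed simp
  ultimately show ?thesis unfolding mu_max_def by (rule antisym[OF _ _, rotated])
qed

lemma rep_ab:
  assumes "ev_periodic pat_ab (\<lambda>j. chain_sym j x)"
  shows "rep x = ereal mu2"
proof -
  let ?\<mu> = "4 * phi - 2"
  have len: "length pat_ab = 3" by simp
  obtain K where K: "\<And>d r. r < 3 \<Longrightarrow> chain_sym (K + 3 * d + r) x = pat_ab ! r"
    using ev_periodicD[OF assms, unfolded len] by blast
  have s: "chain_sym (K + 3 * d) x = Loc_i" "chain_sym (Suc (K + 3 * d)) x = Loc_iii" "chain_sym (Suc (Suc (K + 3 * d))) x = Loc_ii" for d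
    using K[of 0 d] K[of 1 d] K[of 2 d] by simp_all
  \<comment> \<open>From one (i) to the next, w grows by F(j+2) and F(j+1) is replaced by F(j+4) =
    F(j+1) + 2 F(j+2), so 2 w - F(j+1) keeps the value C.\<close>
  define C where "C = 2 * real (loc_len K x) - fib_len (Suc K)"
  have wS: "loc_len (Suc (K + 3 * d)) x = loc_len (K + 3 * d) x" for d using loc_len_Suc[OF codes, of "K + 3 * d"] s by simp
  have w: "2 * real (loc_len (K + 3 * d) x) = fib_len (Suc (K + 3 * d)) + C" for d
  proof (induction d)
    case (Suc d)
    have "loc_len (Suc (Suc (Suc (K + 3 * d)))) x = loc_len (K + 3 * d) x + fib_len (Suc (Suc (K + 3 * d)))"
      using loc_len_Suc[OF codes, of "Suc (K + 3 * d)"] loc_len_Suc[OF codes, of "Suc (Suc (K + 3 * d))"]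
        s[of d] wS[of d] by simp
    moreover have k: "K + 3 * Suc d = Suc (Suc (Suc (K + 3 * d)))" by simp
    ultimately show ?case using Suc unfolding k by simp
  qed (simp add: C_def)
  define e where "e j = phi * real (fib_len (Suc j)) - real (fib_len j)" for j
  have e: "\<bar>e j\<bar> \<le> 1" for j using phi_fib_len[of j] by (simp add: e_def)
  have F: "real (fib_len j) = phi * real (fib_len (Suc j)) - e j" for j by (simp add: e_def)
  have exact: "?\<mu> * (loc_len j x + real (fib_len (Suc (Suc j)))) = fib_len (Suc j) + (e (Suc j) + (2 * phi - 1) * (C - e (Suc j)))"
    if j: "j = K + 3 * d" for j d
  proof -
    have "?\<mu> * (loc_len j x + real (fib_len (Suc (Suc j)))) = (2 * phi - 1) * (2 * real (loc_len j x) + 2 * real (fib_len (Suc (Suc j))))"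
      by (simp add: algebra_simps)
    also have "2 * real (loc_len j x) = phi * real (fib_len (Suc (Suc j))) - e (Suc j) + C"
      using w[of d] F[of "Suc j"] unfolding j by linarith
    \<comment> \<open>Rests on (2 phi - 1) (phi + 2) = phi.\<close>
    also have "(2 * phi - 1) * (phi * real (fib_len (Suc (Suc j))) - e (Suc j) + C + 2 * real (fib_len (Suc (Suc j))))
      = phi * real (fib_len (Suc (Suc j))) + (2 * phi - 1) * (C - e (Suc j))"
      by (simp add: algebra_simps phi_sq_mult del: fib_len_simps)
    finally show ?thesis using F[of "Suc j"] by linarith
  qed
  have err: "\<bar>e j + (2 * phi - 1) * (C - e j)\<bar> \<le> 2 + \<bar>C\<bar>" for j
  proof -
    have "\<bar>(2 * phi - 1) * (C - e j)\<bar> \<le> 1 * \<bar>C - e j\<bar>"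
      unfolding abs_mult using phi_bounds by (intro mult_right_mono) auto
    then show ?thesis
      using e[of j] abs_triangle_ineq[of "e j" "(2 * phi - 1) * (C - e j)"] abs_triangle_ineq4[of C "e j"] by linarith
  qed
  have pos: "K \<le> j \<Longrightarrow> \<exists>d. j = K + 3 * d \<or> j = Suc (K + 3 * d) \<or> j = Suc (Suc (K + 3 * d))" for j
    by presburger
  have "ereal (1 + ?\<mu>) \<le> rep x"
  proof (rule rep_ge_limit[OF codes, of ?\<mu> K "2 + \<bar>C\<bar>"])
    show "0 < ?\<mu>" "?\<mu> \<le> 1" using phi_bounds by linarith+
  next
    fix j assume j: "K \<le> j"
    have "?\<mu> * fib_len (Suc j) \<le> phi * fib_len (Suc j)"
      using phi_bounds by (intro mult_right_mono) auto
    then show "?\<mu> * fib_len (Suc j) \<le> fib_len j + (2 + \<bar>C\<bar>)" using phi_fib_len[of j] by linarith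
    obtain d where d: "j = K + 3 * d \<or> j = Suc (K + 3 * d) \<or> j = Suc (Suc (K + 3 * d))"
      using pos[OF j] by blast
    show "?\<mu> * (loc_len j x + fib_len (Suc (Suc j))) \<le> fib_len (Suc j) + (2 + \<bar>C\<bar>)" if "chain_sym j x = Loc_i"
    proof -
      have "j = K + 3 * d" using d that s[of d] by auto
      then show ?thesis using exact[of j d] err[of "Suc j"] by (simp del: fib_len_simps)
    qed
    show "?\<mu> * fib_len (Suc (Suc (Suc j))) \<le> fib_len (Suc j) + loc_len j x + (2 + \<bar>C\<bar>)"
      if "chain_sym j x = Loc_iii" "chain_sym (Suc j) x = Loc_ii"
    proof -
      have "j = Suc (K + 3 * d)" using d that s[of d] by auto
      then obtain i where i: "j = Suc i" "i = K + 3 * d" by blast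
      let ?G = "real (fib_len (Suc (Suc i)))" and ?H = "real (fib_len (Suc i))"
      have "2 * real (loc_len j x) = ?H + C" using w[of d] wS[of d] i by simp
      \<comment> \<open>The ratio at (iii)(ii) tends to 1 / 2, and 48 / 100 lies between 4 phi - 2,
        about 0.472, and 1 / 2.\<close>
      moreover have "?\<mu> * fib_len (Suc (Suc (Suc j))) \<le> 48 / 100 * fib_len (Suc (Suc (Suc j)))"
        using phi_bounds by (intro mult_right_mono) auto
      moreover have "real (fib_len (Suc (Suc (Suc j)))) = 2 * ?G + ?H" using i by simp
      moreover have "fib_len (Suc i) \<le> fib_len (Suc (Suc i))" by (rule fib_len_mono) simp
      ultimately show ?thesis unfolding i(1) of_nat_add by linarith
    qed
  qed
  moreover have "rep x \<le> ereal (1 + ?\<mu>)"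
  proof (rule rep_le_limit[OF codes, of ?\<mu> "2 + \<bar>C\<bar>"])
    fix N
    have "fib_len (Suc (K + 3 * N)) \<le> ?\<mu> * (loc_len (K + 3 * N) x + fib_len (Suc (Suc (K + 3 * N)))) + (2 + \<bar>C\<bar>)"
      using exact[OF refl, of N] err[of "Suc (K + 3 * N)"] by (simp del: fib_len_simps)
    then show "\<exists>j\<ge>N. chain_sym j x = Loc_i \<and> fib_len (Suc j) \<le> ?\<mu> * (loc_len j x + fib_len (Suc (Suc j))) + (2 + \<bar>C\<bar>)"
      using s(1)[of N] by (intro exI[of _ "K + 3 * N"]) auto
  qed (use phi_bounds in linarith)
  ultimately show ?thesis unfolding mu2_eq by (rule antisym[OF _ _, rotated])
qed

lemma rep_bbaa:
  assumes "ev_periodic pat_bbaa (\<lambda>j. chain_sym j x)"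
  shows "rep x = ereal mu3"
proof -
  define \<mu> where "\<mu> = 4 / (5 * phi + 6)"
  have \<mu>: "440035 / 1000000 < \<mu>" "\<mu> < 440037 / 1000000" unfolding \<mu>_def by (rule mu3_bounds)+
  have \<mu>_eq: "\<mu> * (5 + phi) = 4 * phi"
  proof -
    have "5 * phi + 6 \<noteq> 0" using phi_pos by linarith
    moreover have "phi * (5 * phi + 6) = 5 + phi" using phi_sq by (simp add: algebra_simps)
    ultimately show ?thesis unfolding \<mu>_def by (simp add: field_simps)
  qed
  have len: "length pat_bbaa = 6" by simp
  obtain K where K: "\<And>d r. r < 6 \<Longrightarrow> chain_sym (K + 6 * d + r) x = pat_bbaa ! r"
    using ev_periodicD[OF assms, unfolded len] by blast
  \<comment> \<open>The index of the first (i) in a block aa.\<close>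
  define k where "k d = K + 6 * d + 2" for d
  have s: "chain_sym (k d) x = Loc_i" "chain_sym (k d + 1) x = Loc_iii" "chain_sym (k d + 2) x = Loc_i" "chain_sym (k d + 3) x = Loc_iii"
    "chain_sym (k d + 4) x = Loc_ii" "chain_sym (k d + 5) x = Loc_ii" for d
    using K[of 2 d] K[of 3 d] K[of 4 d] K[of 5 d] K[of 0 "Suc d"] K[of 1 "Suc d"]
    by (simp_all add: k_def eval_nat_numeral)
  \<comment> \<open>Over one period w grows by F(k+4) + F(k+5) = F(k+6), and F(k+9) - F(k+3) = 4
    F(k+6), so 4 w - F(k+3) keeps the value C. Hence the ratio at this (i) tends to 4 phi / (5 +
    phi), which is \<open>\<mu>\<close>.\<close>
  define C where "C = 4 * real (loc_len (k 0) x) - fib_len (k 0 + 3)"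
  have wS: "loc_len (k d + 2) x = loc_len (k d) x" "loc_len (k d + 3) x = loc_len (k d) x" "loc_len (k d + 6) x = loc_len (k d) x + fib_len (k d + 4) + fib_len (k d + 5)" for d
    using loc_len_Suc[OF codes, of "k d"] loc_len_Suc[OF codes, of "k d + 1"] loc_len_Suc[OF codes, of "k d + 2"]
      loc_len_Suc[OF codes, of "k d + 3"] loc_len_Suc[OF codes, of "k d + 4"] loc_len_Suc[OF codes, of "k d + 5"]
      s[of d] by (simp_all add: eval_nat_numeral)
  have w: "4 * real (loc_len (k d) x) = fib_len (k d + 3) + C" for d
  proof (induction d)
    case (Suc d)
    have k: "k (Suc d) = k d + 6" by (simp add: k_def)
    show ?case unfolding k wS using Suc by (simp add: eval_nat_numeral)
  qed (simp add: C_def)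
  define e where "e j = phi * real (fib_len (Suc j)) - real (fib_len j)" for j
  have e: "\<bar>e j\<bar> \<le> 1" for j using phi_fib_len[of j] by (simp add: e_def)
  have F: "real (fib_len j) = phi * real (fib_len (Suc j)) - e j" for j by (simp add: e_def)
  have exact: "\<mu> * (loc_len j x + real (fib_len (Suc (Suc j)))) = fib_len (Suc j) + (e (Suc j) + \<mu> / 4 * (C - e (Suc j)))"
    if j: "j = k d" for j d
  proof -
    have "fib_len (k d + 3) = fib_len (Suc (Suc j)) + fib_len (Suc j)" unfolding j by (simp add: eval_nat_numeral)
    then have w4: "4 * real (loc_len j x) = real (fib_len (Suc (Suc j))) + (phi * real (fib_len (Suc (Suc j))) - e (Suc j)) + C"
      using w[of d] F[of "Suc j"] unfolding j by linarith
    have "4 * (\<mu> * (loc_len j x + real (fib_len (Suc (Suc j))))) = \<mu> * (4 * real (loc_len j x) + 4 * real (fib_len (Suc (Suc j))))"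
      by (simp add: algebra_simps del: fib_len_simps)
    also have "\<dots> = \<mu> * (5 + phi) * real (fib_len (Suc (Suc j))) + \<mu> * (C - e (Suc j))"
      unfolding w4 by (simp add: algebra_simps del: fib_len_simps)
    finally show ?thesis unfolding \<mu>_eq using F[of "Suc j"]
      by (simp only: mult.assoc distrib_left right_diff_distrib)
  qed
  have err: "\<bar>e j + \<mu> / 4 * (C - e j)\<bar> \<le> 2 + \<bar>C\<bar>" for j
  proof -
    have "\<bar>\<mu> / 4 * (C - e j)\<bar> \<le> 1 * \<bar>C - e j\<bar>"
      unfolding abs_mult using \<mu> by (intro mult_right_mono) auto
    then show ?thesis
      using e[of j] abs_triangle_ineq[of "e j" "\<mu> / 4 * (C - e j)"] abs_triangle_ineq4[of C "e j"] by linarith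
  qed
  have pos: "\<exists>d. j = k d \<or> j = k d + 1 \<or> j = k d + 2 \<or> j = k d + 3 \<or> j = k d + 4 \<or> j = k d + 5"
    if "K + 2 \<le> j" for j
  proof -
    have "j = k ((j - (K + 2)) div 6) + (j - (K + 2)) mod 6" using that by (simp add: k_def)
    moreover have "(j - (K + 2)) mod 6 < 6" by simp
    then have "(j - (K + 2)) mod 6 \<in> {0, 1, 2, 3, 4, 5}" by (simp only: insert_iff empty_iff) linarith
    ultimately show ?thesis by (metis add_0_right insert_iff empty_iff)
  qed
  \<comment> \<open>0.4401 separates \<open>\<mu>\<close>, about 0.44004, from the limits of the
    other ratios; the closest is about 0.44098, at (iii)(ii).\<close>
  have cmp: "\<mu> * real m \<le> 4401 / 10000 * real m" for m :: nat
    using \<mu> by (intro mult_right_mono) auto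
  have ratio: "618033 / 1000000 * real (fib_len (Suc j)) \<le> real (fib_len j) + 1"
    "real (fib_len j) \<le> 618034 / 1000000 * real (fib_len (Suc j)) + 1" for j
  proof -
    have "618033 / 1000000 * real (fib_len (Suc j)) \<le> phi * fib_len (Suc j)"
      "phi * fib_len (Suc j) \<le> 618034 / 1000000 * real (fib_len (Suc j))"
      using phi_bounds by (intro mult_right_mono; simp)+
    then show "618033 / 1000000 * real (fib_len (Suc j)) \<le> real (fib_len j) + 1"
      "real (fib_len j) \<le> 618034 / 1000000 * real (fib_len (Suc j)) + 1"
      using phi_fib_len[of j] by linarith+
  qed
  let ?D = "10 + \<bar>C\<bar>"
  have "ereal (1 + \<mu>) \<le> rep x"
  proof (rule rep_ge_limit[OF codes, of \<mu> "K + 2" ?D])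
    show "0 < \<mu>" "\<mu> \<le> 1" using \<mu> by linarith+
  next
    fix j assume j: "K + 2 \<le> j"
    show "\<mu> * fib_len (Suc j) \<le> fib_len j + ?D" using ratio(1)[of j] cmp[of "fib_len (Suc j)"] by linarith
    obtain d where d: "j = k d \<or> j = k d + 1 \<or> j = k d + 2 \<or> j = k d + 3 \<or> j = k d + 4 \<or> j = k d + 5"
      using pos[OF j] by blast
    show "\<mu> * (loc_len j x + fib_len (Suc (Suc j))) \<le> fib_len (Suc j) + ?D" if "chain_sym j x = Loc_i"
    proof -
      have "j = k d \<or> j = k d + 2" using d that s[of d] by (elim disjE) simp_all
      then show ?thesis
      proof
        assume "j = k d"
        then show ?thesis using exact[of j d] err[of "Suc j"] by (simp del: fib_len_simps)
      next
        assume j: "j = k d + 2"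
        have "4 * real (loc_len j x) = fib_len (Suc j) + C" using w[of d] wS(1)[of d] j by (simp add: eval_nat_numeral)
        moreover have "real (fib_len j) \<le> real (fib_len (Suc j))" by (intro of_nat_mono fib_len_mono) simp
        moreover have "4401 / 10000 * (a + (h + f)) \<le> h + (10 + \<bar>c\<bar>)"
          if "4 * a = h + c" "f \<le> h" "0 \<le> h" for a f h c :: real
        proof -
          have "c \<le> \<bar>c\<bar>" "0 \<le> \<bar>c\<bar>" by simp_all
          then show ?thesis using that by (simp add: field_simps)
        qed
        ultimately have "4401 / 10000 * (real (loc_len j x) + real (fib_len (Suc (Suc j)))) \<le>
            fib_len (Suc j) + ?D" by simp
        then show ?thesis using cmp[of "loc_len j x + fib_len (Suc (Suc j))"]
          unfolding of_nat_add by (rule order_trans[rotated])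
      qed
    qed
    show "\<mu> * fib_len (Suc (Suc (Suc j))) \<le> fib_len (Suc j) + loc_len j x + ?D"
      if "chain_sym j x = Loc_iii" "chain_sym (Suc j) x = Loc_ii"
    proof -
      have j: "j = k d + 3" using d that s[of d] by (elim disjE) (simp_all add: eval_nat_numeral)
      have "4 * real (loc_len j x) = fib_len j + C" using w[of d] wS(2)[of d] j by simp
      moreover have "real (fib_len (Suc (Suc (Suc j)))) = 2 * real (fib_len (Suc j)) + fib_len j" by simp
      ultimately show ?thesis using ratio[of j] cmp[of "fib_len (Suc (Suc (Suc j)))"] by simp
    qed
  qed
  moreover have "rep x \<le> ereal (1 + \<mu>)"
  proof (rule rep_le_limit[OF codes, of \<mu> "2 + \<bar>C\<bar>"])
    fix N
    have "fib_len (Suc (k N)) \<le> \<mu> * (loc_len (k N) x + fib_len (Suc (Suc (k N)))) + (2 + \<bar>C\<bar>)"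
      using exact[OF refl, of N] err[of "Suc (k N)"] by (simp del: fib_len_simps)
    then show "\<exists>j\<ge>N. chain_sym j x = Loc_i \<and> fib_len (Suc j) \<le> \<mu> * (loc_len j x + fib_len (Suc (Suc j))) + (2 + \<bar>C\<bar>)"
      using s(1)[of N] by (intro exI[of _ "k N"]) (auto simp: k_def)
  qed (use \<mu> in linarith)
  ultimately show ?thesis unfolding mu3_eq \<mu>_def[symmetric] by (rule antisym[OF _ _, rotated])
qed

end

section \<open>Sturmian words and their codings\<close>

lemma codes_floor:
  assumes "\<And>n. int (x !! n) = \<lfloor>\<rho> + real (Suc n) * phi\<rfloor> - \<lfloor>\<rho> + real n * phi\<rfloor>"
  shows "codes (\<rho> - \<lfloor>\<rho>\<rfloor>) x"
proof -
  have "codes \<alpha> x" if "\<exists>\<rho>::real. \<alpha> = \<rho> - \<lfloor>\<rho>\<rfloor> \<and> (\<forall>n. int (x !! n) = \<lfloor>\<rho> + real (Suc n) * phi\<rfloor> - \<lfloor>\<rho> + real n * phi\<rfloor>)" for \<alpha> x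
    using that
  proof (coinduction arbitrary: \<alpha> x rule: codes.coinduct)
    case codes
    then obtain \<rho> :: real where \<rho>: "\<alpha> = \<rho> - \<lfloor>\<rho>\<rfloor>"
      "\<And>n. int (x !! n) = \<lfloor>\<rho> + real (Suc n) * phi\<rfloor> - \<lfloor>\<rho> + real n * phi\<rfloor>" by blast
    have a: "int (shd x) = \<lfloor>\<rho> + phi\<rfloor> - \<lfloor>\<rho>\<rfloor>" using \<rho>(2)[of 0] by simp
    have "\<lfloor>\<rho> + phi\<rfloor> \<le> \<lfloor>\<rho> + 1\<rfloor>" by (rule floor_mono) simp
    then have "shd x = 0 \<or> shd x = 1" using a by linarith
    have "\<alpha> + phi - real (shd x) = \<rho> + phi - \<lfloor>\<rho> + phi\<rfloor>"
      using arg_cong[OF a, of real_of_int] \<rho>(1) by simp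
    moreover have "int (stl x !! n) = \<lfloor>\<rho> + phi + real (Suc n) * phi\<rfloor> - \<lfloor>\<rho> + phi + real n * phi\<rfloor>" for n
      using \<rho>(2)[of "Suc n"] by (simp add: algebra_simps)
    ultimately have "\<exists>\<rho>'::real. \<alpha> + phi - real (shd x) = \<rho>' - \<lfloor>\<rho>'\<rfloor> \<and>
        (\<forall>n. int (stl x !! n) = \<lfloor>\<rho>' + real (Suc n) * phi\<rfloor> - \<lfloor>\<rho>' + real n * phi\<rfloor>)"
      by blast
    moreover have "0 \<le> \<alpha>" "\<alpha> \<le> 1" unfolding \<rho>(1) by linarith+
    ultimately show ?case using \<open>shd x = 0 \<or> shd x = 1\<close>
      by (intro exI[of _ \<alpha>] exI[of _ "shd x"] exI[of _ "stl x"]) simp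
  qed
  then show ?thesis using assms by blast
qed

text \<open>The summand 1 puts the point into (0, 1], the range matching the ceilings.\<close>

lemma codes_ceiling:
  assumes "\<And>n. int (x !! n) = \<lceil>\<rho> + real (Suc n) * phi\<rceil> - \<lceil>\<rho> + real n * phi\<rceil>"
  shows "codes (\<rho> - \<lceil>\<rho>\<rceil> + 1) x"
proof -
  have "codes \<alpha> x" if "\<exists>\<rho>::real. \<alpha> = \<rho> - \<lceil>\<rho>\<rceil> + 1 \<and> (\<forall>n. int (x !! n) = \<lceil>\<rho> + real (Suc n) * phi\<rceil> - \<lceil>\<rho> + real n * phi\<rceil>)" for \<alpha> x
    using that
  proof (coinduction arbitrary: \<alpha> x rule: codes.coinduct)
    case codes
    then obtain \<rho> :: real where \<rho>: "\<alpha> = \<rho> - \<lceil>\<rho>\<rceil> + 1"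
      "\<And>n. int (x !! n) = \<lceil>\<rho> + real (Suc n) * phi\<rceil> - \<lceil>\<rho> + real n * phi\<rceil>" by blast
    have a: "int (shd x) = \<lceil>\<rho> + phi\<rceil> - \<lceil>\<rho>\<rceil>" using \<rho>(2)[of 0] by simp
    have "\<lceil>\<rho> + phi\<rceil> \<le> \<lceil>\<rho> + 1\<rceil>" by (rule ceiling_mono) simp
    then have "shd x = 0 \<or> shd x = 1" using a by linarith
    have "\<alpha> + phi - real (shd x) = \<rho> + phi - \<lceil>\<rho> + phi\<rceil> + 1"
      using arg_cong[OF a, of real_of_int] \<rho>(1) by simp
    moreover have "int (stl x !! n) = \<lceil>\<rho> + phi + real (Suc n) * phi\<rceil> - \<lceil>\<rho> + phi + real n * phi\<rceil>" for n
      using \<rho>(2)[of "Suc n"] by (simp add: algebra_simps)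
    ultimately have "\<exists>\<rho>'::real. \<alpha> + phi - real (shd x) = \<rho>' - \<lceil>\<rho>'\<rceil> + 1 \<and>
        (\<forall>n. int (stl x !! n) = \<lceil>\<rho>' + real (Suc n) * phi\<rceil> - \<lceil>\<rho>' + real n * phi\<rceil>)"
      by blast
    moreover have "0 \<le> \<alpha>" "\<alpha> \<le> 1" unfolding \<rho>(1) by linarith+
    ultimately show ?case using \<open>shd x = 0 \<or> shd x = 1\<close>
      by (intro exI[of _ \<alpha>] exI[of _ "shd x"] exI[of _ "stl x"]) simp
  qed
  then show ?thesis using assms by blast
qed

lemma sturmian_codes:
  assumes "sturmian_word phi x"
  shows "\<exists>\<alpha>. codes \<alpha> x"
proof -
  obtain \<rho> where "(\<forall>n\<ge>1. int (x !! (n - 1)) = \<lfloor>real (n + 1) * phi + \<rho>\<rfloor> - \<lfloor>real n * phi + \<rho>\<rfloor>) \<or>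
     (\<forall>n\<ge>1. int (x !! (n - 1)) = \<lceil>real (n + 1) * phi + \<rho>\<rceil> - \<lceil>real n * phi + \<rho>\<rceil>)"
    using assms unfolding sturmian_word_def by blast
  then show ?thesis
  proof
    assume *: "\<forall>n\<ge>1. int (x !! (n - 1)) = \<lfloor>real (n + 1) * phi + \<rho>\<rfloor> - \<lfloor>real n * phi + \<rho>\<rfloor>"
    \<comment> \<open>The word starts with the letter of index 1, hence the shift of
      \<open>\<rho>\<close> by phi.\<close>
    have "int (x !! n) = \<lfloor>(\<rho> + phi) + real (Suc n) * phi\<rfloor> - \<lfloor>(\<rho> + phi) + real n * phi\<rfloor>" for n
      using *[rule_format, of "Suc n"] by (simp add: algebra_simps)
    then show ?thesis using codes_floor by blast
  next
    assume *: "\<forall>n\<ge>1. int (x !! (n - 1)) = \<lceil>real (n + 1) * phi + \<rho>\<rceil> - \<lceil>real n * phi + \<rho>\<rceil>"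
    have "int (x !! n) = \<lceil>(\<rho> + phi) + real (Suc n) * phi\<rceil> - \<lceil>(\<rho> + phi) + real n * phi\<rceil>" for n
      using *[rule_format, of "Suc n"] by (simp add: algebra_simps)
    then show ?thesis using codes_ceiling by blast
  qed
qed

section \<open>Sturmian words with prescribed periodic chains\<close>

lemma sturmian_word_exists:
  assumes "0 \<le> \<alpha>" "\<alpha> < 1"
  shows "\<exists>x. sturmian_word phi x \<and> codes \<alpha> x"
proof -
  define x where "x = smap (\<lambda>n. nat (\<lfloor>\<alpha> + real (Suc n) * phi\<rfloor> - \<lfloor>\<alpha> + real n * phi\<rfloor>)) nats"
  have x: "int (x !! n) = \<lfloor>\<alpha> + real (Suc n) * phi\<rfloor> - \<lfloor>\<alpha> + real n * phi\<rfloor>" for n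
  proof -
    have "\<lfloor>\<alpha> + real n * phi\<rfloor> \<le> \<lfloor>\<alpha> + real (Suc n) * phi\<rfloor>"
      by (intro floor_mono) (simp add: algebra_simps)
    then show ?thesis by (simp add: x_def)
  qed
  have "\<lfloor>\<alpha>\<rfloor> = 0" using assms by (simp add: floor_eq_iff)
  then have "codes \<alpha> x" using codes_floor[OF x] by simp
  moreover have "int (x !! (n - 1)) = \<lfloor>real (n + 1) * phi + (\<alpha> - phi)\<rfloor> - \<lfloor>real n * phi + (\<alpha> - phi)\<rfloor>"
    if "1 \<le> n" for n
    using x[of "n - 1"] that by (simp add: of_nat_diff algebra_simps)
  then have "sturmian_word phi x" unfolding sturmian_word_def using phi_irrational by auto
  ultimately show ?thesis by blast
qed

text \<open>Points whose first two letters, and hence the symbol, are forced; the omitted points 1 -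
  phi and 2 (1 - phi) admit two codings.\<close>

definition sym_state :: "real \<Rightarrow> loc_symbol \<Rightarrow> bool" where
  "sym_state \<alpha> s \<longleftrightarrow> (case s of Loc_iii \<Rightarrow> \<alpha> < 1 - phi
     | Loc_ii \<Rightarrow> 1 - phi < \<alpha> \<and> \<alpha> < 2 * (1 - phi)
     | Loc_i \<Rightarrow> 2 * (1 - phi) < \<alpha>)"

definition next_state :: "real \<Rightarrow> loc_symbol \<Rightarrow> real" where
  "next_state \<alpha> s = (if s = Loc_iii then 1 - (1 + phi) * \<alpha> else (1 + phi) * (1 - \<alpha>))"

lemma sym_state_step:
  assumes "codes \<alpha> x" "sym_state \<alpha> s"
  shows "sym_init x = s" "codes (next_state \<alpha> s) (desub x)"
proof -
  have hd: "shd x = (if s = Loc_iii then 0 else 1)"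
    using codes_hd[OF assms(1)] codes_hd_0[OF assms(1)] codes_hd_1[OF assms(1)] assms(2) phi_bounds
    by (cases s) (auto simp: sym_state_def)
  note 1 = codes_stl[OF assms(1)]
  show "sym_init x = s"
    using hd codes_hd[OF 1] codes_hd_0[OF 1] codes_hd_1[OF 1] assms(2)
    by (cases s) (auto simp: sym_init_def sym_state_def)
  show "codes (next_state \<alpha> s) (desub x)"
    using codes_desub[OF assms(1)] hd by (auto simp: next_state_def split: if_splits)
qed

lemma periodic_chain:
  assumes x: "codes (a ! 0) x" and len: "length a = length p" "p \<noteq> []"
    and step: "\<And>i. i < length p \<Longrightarrow> sym_state (a ! i) (p ! i) \<and>
      next_state (a ! i) (p ! i) = a ! (Suc i mod length p)"
  shows "chain_sym n x = p ! (n mod length p)"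
proof -
  have c: "codes (a ! (n mod length p)) ((desub ^^ n) x)" for n
  proof (induction n)
    case (Suc n)
    have "n mod length p < length p" using len(2) by simp
    note st = step[OF this]
    show ?case using sym_state_step(2)[OF Suc st[THEN conjunct1]] st by (simp add: mod_Suc_eq)
  qed (use x in simp)
  show ?thesis unfolding chain_sym_def
    using sym_state_step(1)[OF c] step[of "n mod length p"] len(2) by simp
qed

lemma exists_a: "\<exists>x. sturmian_word phi x \<and> rep x = ereal mu_max"
proof -
  obtain x where x: "sturmian_word phi x" "codes 0 x" using sturmian_word_exists[of 0] by auto
  have chain_sym: "chain_sym n x = [Loc_iii, Loc_i] ! (n mod length [Loc_iii, Loc_i])" for n
  \<comment> \<open>The affine maps exchange 0 and 1. The cycle is entered at 0, as
    \<open>sturmian_word_exists\<close> asks for a point below 1, so the chain starts with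
    (iii).\<close>
  proof (rule periodic_chain[of "[0, 1]"])
    fix i assume "i < length [Loc_iii, Loc_i]"
    then have "i = 0 \<or> i = 1" by auto
    then show "sym_state ([0, 1] ! i) ([Loc_iii, Loc_i] ! i) \<and>
      next_state ([0, 1] ! i) ([Loc_iii, Loc_i] ! i) = [0, 1] ! (Suc i mod length [Loc_iii, Loc_i])"
      using phi_bounds by (auto simp: sym_state_def next_state_def)
  qed (use x in auto)
  have len: "length [Loc_i, Loc_iii] = 2" "length [Loc_iii, Loc_i] = 2" by simp_all
  have "ev_periodic [Loc_i, Loc_iii] (\<lambda>j. chain_sym j x)"
  proof (rule ev_periodicI[of _ _ 1])
    fix d r :: nat assume "r < length [Loc_i, Loc_iii]"
    then have "r = 0 \<or> r = 1" by auto
    then show "chain_sym (1 + length [Loc_i, Loc_iii] * d + r) x = [Loc_i, Loc_iii] ! r"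
      unfolding chain_sym len by (elim disjE) simp_all
  qed simp
  then show ?thesis using rep_a[OF x(2)] x(1) by blast
qed

lemma ev_periodic_refl: "(\<And>n. s n = p ! (n mod length p)) \<Longrightarrow> ev_periodic p s"
  unfolding ev_periodic_def by (intro exI[of _ 0]) simp

lemma exists_ab: "\<exists>x. sturmian_word phi x \<and> rep x = ereal mu2"
proof -
  \<comment> \<open>The cycle of the affine maps along ab: (1 + phi) / 2 goes to phi / 2, then to 1
    / 2 and back.\<close>
  let ?a = "[(1 + phi) / 2, phi / 2, 1 / 2]" and ?p = "[Loc_i, Loc_iii, Loc_ii]"
  have "0 \<le> (1 + phi) / 2" "(1 + phi) / 2 < 1" using phi_bounds by auto
  then obtain x where x: "sturmian_word phi x" "codes ((1 + phi) / 2) x"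
    using sturmian_word_exists by blast
  have "chain_sym n x = ?p ! (n mod length ?p)" for n
  proof (rule periodic_chain[of ?a])
    fix i assume "i < length ?p"
    then have "i = 0 \<or> i = 1 \<or> i = 2" by auto
    then show "sym_state (?a ! i) (?p ! i) \<and> next_state (?a ! i) (?p ! i) = ?a ! (Suc i mod length ?p)"
      using phi_bounds by (elim disjE) (simp_all add: sym_state_def next_state_def field_simps phi_sq phi_sq_mult)
  qed (use x in auto)
  then have "ev_periodic ?p (\<lambda>j. chain_sym j x)" by (rule ev_periodic_refl)
  then show ?thesis using rep_ab[OF x(2)] x(1) by blast
qed

lemma exists_bbaa: "\<exists>x. sturmian_word phi x \<and> rep x = ereal mu3"
proof -
  \<comment> \<open>3 / 4 is fixed by the composition of the six affine maps along bbaa; the other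
    entries are its successive images.\<close>
  let ?a = "[3 / 4, (1 + phi) / 4, (2 + 3 * phi) / 4, (2 * phi - 1) / 4, (3 + phi) / 4, phi / 4]"
  let ?p = "[Loc_ii, Loc_ii, Loc_i, Loc_iii, Loc_i, Loc_iii]"
  obtain x where x: "sturmian_word phi x" "codes (3 / 4) x"
    using sturmian_word_exists[of "3 / 4"] by auto
  have "chain_sym n x = ?p ! (n mod length ?p)" for n
  proof (rule periodic_chain[of ?a])
    fix i assume "i < length ?p"
    then have "i = 0 \<or> i = 1 \<or> i = 2 \<or> i = 3 \<or> i = 4 \<or> i = 5" by auto
    then show "sym_state (?a ! i) (?p ! i) \<and> next_state (?a ! i) (?p ! i) = ?a ! (Suc i mod length ?p)"
      using phi_bounds by (elim disjE) (simp_all add: sym_state_def next_state_def field_simps phi_sq phi_sq_mult)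
  qed (use x in auto)
  then have "ev_periodic ?p (\<lambda>j. chain_sym j x)" by (rule ev_periodic_refl)
  then show ?thesis using rep_bbaa[OF x(2)] x(1) by blast
qed

section \<open>The gaps and the chains attaining their lower ends\<close>

lemma mu_order: "11 / 25 < mu3 - 1" "mu3 < mu2" "mu2 < mu_max"
  unfolding mu3_eq mu2_eq mu_max_def using mu3_bounds phi_bounds by linarith+

text \<open>As \<open>mu3\<close> exceeds 1 + 11 / 25, the classification applies. Both the gaps and
  the descriptions by chains are read off from this trichotomy.\<close>

lemma rep_cases:
  assumes "codes \<alpha> x" "ereal mu3 \<le> rep x"
  obtains "ereal mu_max \<le> rep x"
  | "rep x = ereal mu2" "ev_periodic pat_ab (\<lambda>j. chain_sym j x)"
  | "rep x = ereal mu3" "ev_periodic pat_bbaa (\<lambda>j. chain_sym j x)"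
proof -
  have "ereal (1 + 11 / 25) < ereal mu3" using mu_order(1) by simp
  then have "ereal (1 + 11 / 25) < rep x" using assms(2) by (rule less_le_trans)
  from rep_large_cases[OF assms(1) this] show ?thesis
    using rep_a[OF assms(1)] rep_ge_b[OF assms(1)] rep_ab[OF assms(1)] rep_bbaa[OF assms(1)] that
    by fastforce
qed

lemma maximal_gapI:
  assumes "mu3 \<le> c" "c < d" "(c = mu2 \<and> d = mu_max) \<or> (c = mu3 \<and> d = mu2)"
  shows "maximal_gap phi c d"
proof -
  have "rep x \<notin> {ereal c<..<ereal d}" if st: "sturmian_word phi x" for x
  proof
    assume r: "rep x \<in> {ereal c<..<ereal d}"
    obtain \<alpha> where codes: "codes \<alpha> x" using sturmian_codes[OF st] by blast
    have "ereal mu3 \<le> rep x" using r assms(1) by (meson ereal_less_eq(3) greaterThanLessThan_iff less_imp_le order_trans)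
    then show False
    proof (cases rule: rep_cases[OF codes, consumes 1])
      case 1
      moreover have "rep x < ereal d" using r by simp
      ultimately have "mu_max < d" using le_less_trans by fastforce
      then show False using assms(3) mu_order by auto
    qed (use r assms(3) mu_order in auto)
  qed
  then show ?thesis using assms exists_a exists_ab exists_bbaa
    unfolding maximal_gap_def rep_spectrum_def by auto
qed

theorem theorem1p5:
  shows "maximal_gap phi mu2 mu_max \<and> maximal_gap phi mu3 mu2 \<and>
    (\<forall>x. sturmian_word phi x \<longrightarrow>
       (rep x = ereal mu2 \<longleftrightarrow>
          (\<exists>u. locating_chain x = u @- cycle (chain_a @ chain_b))) \<and>
       (rep x = ereal mu3 \<longleftrightarrow>
          (\<exists>v. locating_chain x = v @- cycle (chain_b @ chain_b @ chain_a @ chain_a))))"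
proof (intro conjI allI impI)
  show "maximal_gap phi mu2 mu_max" "maximal_gap phi mu3 mu2"
    using mu_order by (auto intro!: maximal_gapI)
next
  fix x assume "sturmian_word phi x"
  then obtain \<alpha> where codes: "codes \<alpha> x" using sturmian_codes by blast
  have chain: "snth (locating_chain x) = (\<lambda>j. chain_sym j x)"
    using locating_chain_snth[OF codes] by blast
  have ab: "(\<exists>u. locating_chain x = u @- cycle (chain_a @ chain_b)) \<longleftrightarrow> ev_periodic pat_ab (\<lambda>j. chain_sym j x)"
    unfolding chain[symmetric] by (subst ev_periodic_cycle) (simp_all add: chain_a_def chain_b_def)
  have bbaa: "(\<exists>v. locating_chain x = v @- cycle (chain_b @ chain_b @ chain_a @ chain_a)) \<longleftrightarrow>
      ev_periodic pat_bbaa (\<lambda>j. chain_sym j x)"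
    unfolding chain[symmetric] by (subst ev_periodic_cycle) (simp_all add: chain_a_def chain_b_def)
  show "rep x = ereal mu2 \<longleftrightarrow> (\<exists>u. locating_chain x = u @- cycle (chain_a @ chain_b))"
    unfolding ab
  proof
    assume r: "rep x = ereal mu2"
    then have "ereal mu3 \<le> rep x" using mu_order by simp
    then show "ev_periodic pat_ab (\<lambda>j. chain_sym j x)"
      by (cases rule: rep_cases[OF codes, consumes 1]) (use r mu_order in auto)
  qed (rule rep_ab[OF codes])
  show "rep x = ereal mu3 \<longleftrightarrow> (\<exists>v. locating_chain x = v @- cycle (chain_b @ chain_b @ chain_a @ chain_a))"
    unfolding bbaa
  proof
    assume r: "rep x = ereal mu3"
    then have "ereal mu3 \<le> rep x" by simp
    then show "ev_periodic pat_bbaa (\<lambda>j. chain_sym j x)"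
      by (cases rule: rep_cases[OF codes, consumes 1]) (use r mu_order in auto)
  qed (rule rep_bbaa[OF codes])
qed

end
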